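(* Let $\nu$ be an absolutely continuous probability measure on $[0,2\pi]$ (identified with the unit circle) from the Szegő class, i.e. with density $\nu'\in\mathcal L^-[0,2\pi]$. Then $\nu$ is the radial projection of the harmonic measure of some strictly star-shaped domain: there is a strictly star-shaped domain $\Omega$ with $\nu=\widehat\omega_\Omega$.
   Context: $\mathcal L^-[a,b]$ is the class of all nonnegative integrable functions $g$ on $[a,b]$ such that $\int_a^b\log^-g(s)\,ds<\infty$, where $h^-=\max\{-h,0\}$ (and $\log^-0=+\infty$). Szegő measures are positive measures $\nu$ on the unit circle with $\nu'\in\mathcal L^-[0,2\pi]$. A domain $\Omega\subset\mathbb C$ is strictly star-shaped if it has the form $$\Omega=\{re^{i\theta}:\ 0\le r<r_\Omega(\theta),\ 0\le\theta\le2\pi\}$$ with $r_\Omega$ a positive continuous function on $[0,2\pi]$ with $r_\Omega(0)=r_\Omega(2\pi)$. For a bounded Jordan domain $\Omega$ containing the origin and a set $E\subset\partial\Omega$, $\omega(z,E,\Omega)$ denotes the harmonic measure of $E$ at $z\in\Omega$. The radial projection of the harmonic measure of $\Omega$ (at $0$) is the measure on $[0,2\pi]$ defined by $$\widehat\omega_\Omega(F)=\omega(0,\{\zeta\in\partial\Omega:\arg\zeta\in F\},\Omega)$$ for each Borel set $F\subset[0,2\pi]$. *)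

theory Defs
  imports "HOL-Probability.Probability"
begin

text \<open>The negative part of the logarithm of a nonnegative number. The value at 0 is set
  explicitly, because the library has \<^term>\<open>ln (0::real) = 0\<close>.\<close>

definition log_minus :: "real \<Rightarrow> ennreal" where
  "log_minus x = (if x = 0 then \<infinity> else ennreal (max (- ln x) 0))"

definition L_minus :: "real \<Rightarrow> real \<Rightarrow> (real \<Rightarrow> real) set" where
  "L_minus a b = {g. (\<forall>s\<in>{a..b}. 0 \<le> g s) \<and> set_integrable lborel {a..b} g \<and>
     (\<integral>\<^sup>+s\<in>{a..b}. log_minus (g s) \<partial>lborel) < \<infinity>}"

definition strictly_star_shaped :: "complex set \<Rightarrow> bool" where
  "strictly_star_shaped \<Omega> \<longleftrightarrow> (\<exists>\<rho>::real \<Rightarrow> real.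
     continuous_on {0..2*pi} \<rho> \<and> (\<forall>\<theta>\<in>{0..2*pi}. 0 < \<rho> \<theta>) \<and> \<rho> 0 = \<rho> (2*pi) \<and>
     \<Omega> = {rcis r \<theta> | r \<theta>. 0 \<le> r \<and> r < \<rho> \<theta> \<and> 0 \<le> \<theta> \<and> \<theta> \<le> 2*pi})"

text \<open>Twice continuously differentiable functions with vanishing Laplacian; the two
  components of the gradient and the four second-order partial derivatives are bound
  existentially.\<close>

definition harmonic_on :: "(complex \<Rightarrow> real) \<Rightarrow> complex set \<Rightarrow> bool" where
  "harmonic_on u S \<longleftrightarrow> open S \<and>
     (\<exists>ux uy uxx uxy uyx uyy :: complex \<Rightarrow> real.
        (\<forall>z\<in>S. (u has_derivative (\<lambda>h. ux z * Re h + uy z * Im h)) (at z) \<and>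
               (ux has_derivative (\<lambda>h. uxx z * Re h + uxy z * Im h)) (at z) \<and>
               (uy has_derivative (\<lambda>h. uyx z * Re h + uyy z * Im h)) (at z) \<and>
               uxx z + uyy z = 0) \<and>
        continuous_on S uxx \<and> continuous_on S uxy \<and>
        continuous_on S uyx \<and> continuous_on S uyy)"

text \<open>Harmonic measure at \<open>z\<close> as the measure representing the solution of the Dirichlet
  problem: a Borel probability measure carried by the boundary, whose integral of the boundary
  values of any classical solution \<open>u\<close> is \<open>u z\<close>. On a bounded Jordan domain the Dirichlet
  problem is solvable for all continuous boundary data, so that exactly one such measure
  exists. (Uniqueness can fail for domains with irregular boundary points; the definition
  is not intended for these.)\<close>

definition is_harmonic_measure :: "complex \<Rightarrow> complex set \<Rightarrow> complex measure \<Rightarrow> bool" where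
  "is_harmonic_measure z \<Omega> \<mu> \<longleftrightarrow>
     sets \<mu> = sets borel \<and> prob_space \<mu> \<and> emeasure \<mu> (- frontier \<Omega>) = 0 \<and>
     (\<forall>u. continuous_on (closure \<Omega>) u \<and> harmonic_on u \<Omega> \<longrightarrow>
        (LINT \<zeta>:frontier \<Omega>|\<mu>. u \<zeta>) = u z)"

definition harmonic_measure :: "complex \<Rightarrow> complex set \<Rightarrow> complex set \<Rightarrow> ennreal" where
  "harmonic_measure z E \<Omega> = emeasure (THE \<mu>. is_harmonic_measure z \<Omega> \<mu>) E"

text \<open>The radial projection, a measure on the Borel subsets of \<open>[0, 2\<pi>]\<close>. The argument is
  taken in \<open>[0, 2\<pi>)\<close>; both \<open>0\<close> and \<open>2\<pi>\<close> describe the positive real axis, which for a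
  strictly star-shaped domain meets the boundary in a single point of harmonic measure 0.\<close>

definition radial_projection :: "complex set \<Rightarrow> real measure" where
  "radial_projection \<Omega> = measure_of {0..2*pi} (sets (restrict_space borel {0..2*pi}))
     (\<lambda>F. harmonic_measure 0 {\<zeta> \<in> frontier \<Omega>. Arg2pi \<zeta> \<in> F} \<Omega>)"

end

theory Submission
  imports Defs "HOL-Complex_Analysis.Complex_Analysis"
begin

text \<open>Let \<open>N\<close> be the distribution function of the given measure with density \<open>g\<close> and \<open>s = 2\<pi>N\<close>. The
Szego condition forces \<open>g > 0\<close> almost everywhere, so \<open>s\<close> is an increasing homeomorphism of
\<open>[0, 2\<pi>]\<close>, and it carries the given measure to normalised arc length (\<open>distr_s\<close>). Harmonic measure at
\<open>f 0\<close> of a Jordan domain is the image of normalised arc length under a Riemann map \<open>f\<close> of the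
disc. It is therefore enough to find a conformal map \<open>f\<close> of the disc, continuous and injective
up to the boundary, with \<open>f 0 = 0\<close> and \<open>arg f(exp(i s(\<theta>))) = \<theta>\<close>: the boundary point with
argument \<open>\<theta>\<close> is then hit at the angle \<open>s(\<theta>)\<close>, and the radial projection is the given measure.

The imaginary part of \<open>log (f(z)/z)\<close> is prescribed on the circle, and this determines \<open>f\<close> up to a
positive factor. A suitable choice is
\<open>f(z) = z exp(-i c - (1/\<pi>) \<integral> Ln(1 - z exp(-i s(\<eta>))) d\<eta>)\<close>,
the classical representation of starlike functions after the substitution \<open>x = s(\<eta>)\<close>. On the
circle the imaginary part of the logarithm is piecewise linear in \<open>s(\<theta>) - s(\<eta>)\<close>, jumping at
\<open>\<eta> = \<theta>\<close>; integrating it yields the required argument (\<open>Im_G_boundary\<close>). Inside the disc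
\<open>Re (z f'/f) > 0\<close>, so \<open>log f\<close> in logarithmic coordinates has a derivative with positive real
part and is injective on a half-plane (\<open>inj_on_log_f\<close>).

The real difficulty is that \<open>f\<close> extends continuously to the closed disc, because the integrand
has logarithmic singularities on the circle, and \<open>s\<close> may be very flat near them. The idea is the
elementary inequality
\<open>1/2 log (1/y) \<le> log (1/g) + g y^(-1/2)\<close>.
For \<open>y = |1 - z exp(-i s(\<eta>))|\<close> the first term on the right is integrable by the Szego
condition, while the factor \<open>g\<close> in the second allows the substitution \<open>x = s(\<eta>)\<close>, which turns its integral
into that of \<open>|1 - z exp(-i x)|^(-1/2)\<close>, bounded uniformly in \<open>z\<close>. With two small
parameters built in (\<open>ln_one_plus_le\<close>), the inequality shows that the continuous functions obtained
by adding \<open>\<epsilon> > 0\<close> to the argument of the logarithm converge uniformly on the closed disc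
(\<open>uniform_limit_G_reg\<close>).

Harmonic measure is identified from its defining property
(\<open>is_harmonic_measure_conformal_image_iff\<close>). That the image of arc length has the property is the mean
value theorem for harmonic functions pulled back to the disc. It is the only such measure because
the functions \<open>Re (P (w \<zeta>))\<close>, with \<open>w\<close> the inverse of \<open>f\<close> and \<open>P\<close> a polynomial, are admissible, and
their boundary values are uniformly dense by the Stone-Weierstrass theorem.\<close>

section \<open>Harmonic functions and the mean value property\<close>

text \<open>By the mean value theorem, the second difference of \<open>u\<close> over a small square with corner \<open>z\<close> equals the
area times \<open>uxy\<close> at one point of the square, and also the area times \<open>uyx\<close> at another. Letting the square
shrink, continuity of both partial derivatives gives the claim.\<close>
lemma mixed_partials_eq:
  fixes u ux uy uxy uyx :: "complex \<Rightarrow> real"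
  assumes S: "open S" "z \<in> S"
    and u: "\<And>w. w \<in> S \<Longrightarrow> (u has_derivative (\<lambda>h. ux w * Re h + uy w * Im h)) (at w)"
    and ux: "\<And>w. w \<in> S \<Longrightarrow> (ux has_derivative (\<lambda>h. uxx w * Re h + uxy w * Im h)) (at w)"
    and uy: "\<And>w. w \<in> S \<Longrightarrow> (uy has_derivative (\<lambda>h. uyx w * Re h + uyy w * Im h)) (at w)"
    and cont: "continuous_on S uxy" "continuous_on S uyx"
  shows "uxy z = uyx z"
proof -
  obtain e where e: "e > 0" "ball z e \<subseteq> S" using S openE by blast
  define P where "P x y = z + of_real x + \<i> * of_real y" for x y :: real
  have dx: "((\<lambda>x. v (P x y)) has_real_derivative a) (at x)"
    if "(v has_derivative (\<lambda>h. a * Re h + b * Im h)) (at (P x y))" for v a b x y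
  proof -
    have "((\<lambda>x. P x y) has_derivative (\<lambda>k. of_real k)) (at x)"
      unfolding P_def by (auto intro!: derivative_eq_intros)
    from has_derivative_compose[OF this that] show ?thesis
      by (simp add: has_field_derivative_def mult.commute[of _ a])
  qed
  have dy: "((\<lambda>y. v (P x y)) has_real_derivative b) (at y)"
    if "(v has_derivative (\<lambda>h. a * Re h + b * Im h)) (at (P x y))" for v a b x y
  proof -
    have "((\<lambda>y. P x y) has_derivative (\<lambda>k. \<i> * of_real k)) (at y)"
      unfolding P_def by (auto intro!: derivative_eq_intros)
    from has_derivative_compose[OF this that] show ?thesis
      by (simp add: has_field_derivative_def mult.commute[of _ b])
  qed
  have near: "\<exists>p q. dist p z < 3 * h \<and> dist q z < 3 * h \<and> uxy p = uyx q" if h: "0 < h" "3 * h < e" for h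
  proof -
    have cd: "dist (P x y) z < 3 * h" if "0 \<le> x" "x \<le> h" "0 \<le> y" "y \<le> h" for x y
    proof -
      have "dist (P x y) z = cmod (of_real x + \<i> * of_real y)" by (simp add: P_def dist_norm)
      also have "\<dots> \<le> \<bar>x\<bar> + \<bar>y\<bar>" using norm_triangle_ineq[of "of_real x :: complex" "\<i> * of_real y"] by (simp add: norm_mult)
      also have "\<dots> < 3 * h" using that h by auto
      finally show ?thesis .
    qed
    have S': "P x y \<in> S" if "0 \<le> x" "x \<le> h" "0 \<le> y" "y \<le> h" for x y
      using cd[OF that] h(2) e(2) by (auto simp: dist_commute subset_iff)
    define \<Delta> where "\<Delta> = u (P h h) - u (P h 0) - (u (P 0 h) - u (P 0 0))"
    have "\<exists>x. 0 < x \<and> x < h \<and> (\<lambda>x. u (P x h) - u (P x 0)) h - (\<lambda>x. u (P x h) - u (P x 0)) 0 =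
        (h - 0) * (ux (P x h) - ux (P x 0))"
      by (intro MVT2 DERIV_diff dx[OF u]) (use h S' in auto)
    then obtain x where x: "0 < x" "x < h" "\<Delta> = h * (ux (P x h) - ux (P x 0))"
      by (auto simp: \<Delta>_def)
    have "\<exists>y. 0 < y \<and> y < h \<and> (\<lambda>y. ux (P x y)) h - (\<lambda>y. ux (P x y)) 0 = (h - 0) * uxy (P x y)"
      by (intro MVT2 dy[OF ux]) (use x h S' in auto)
    then obtain y where y: "0 < y" "y < h" "\<Delta> = h * (h * uxy (P x y))"
      using x by auto
    have "\<exists>y. 0 < y \<and> y < h \<and> (\<lambda>y. u (P h y) - u (P 0 y)) h - (\<lambda>y. u (P h y) - u (P 0 y)) 0 =
        (h - 0) * (uy (P h y) - uy (P 0 y))"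
      by (intro MVT2 DERIV_diff dy[OF u]) (use h S' in auto)
    then obtain y' where y': "0 < y'" "y' < h" "\<Delta> = h * (uy (P h y') - uy (P 0 y'))"
      by (auto simp: \<Delta>_def algebra_simps)
    have "\<exists>x. 0 < x \<and> x < h \<and> (\<lambda>x. uy (P x y')) h - (\<lambda>x. uy (P x y')) 0 = (h - 0) * uyx (P x y')"
      by (intro MVT2 dx[OF uy]) (use y' h S' in auto)
    then obtain x' where x': "0 < x'" "x' < h" "\<Delta> = h * (h * uyx (P x' y'))"
      using y' by auto
    have "uxy (P x y) = uyx (P x' y')" using y x' h by simp
    then show ?thesis using cd x x' y y' by (meson less_imp_le)
  qed
  have cont_at: "isCont uxy z" "isCont uyx z"
    using cont S by (simp_all add: continuous_on_eq_continuous_at)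
  show ?thesis
  proof (rule ccontr)
    assume ne: "uxy z \<noteq> uyx z"
    define d where "d = \<bar>uxy z - uyx z\<bar> / 2"
    have d: "d > 0" using ne by (simp add: d_def)
    obtain d1 where d1: "d1 > 0" "\<And>w. dist w z < d1 \<Longrightarrow> \<bar>uxy w - uxy z\<bar> < d"
      using cont_at(1) d unfolding continuous_at_eps_delta dist_real_def by blast
    obtain d2 where d2: "d2 > 0" "\<And>w. dist w z < d2 \<Longrightarrow> \<bar>uyx w - uyx z\<bar> < d"
      using cont_at(2) d unfolding continuous_at_eps_delta dist_real_def by blast
    define h where "h = min e (min d1 d2) / 4"
    have h: "0 < h" "3 * h < e" "3 * h < d1" "3 * h < d2" using e d1 d2 by (auto simp: h_def)
    obtain p q where "dist p z < 3 * h" "dist q z < 3 * h" "uxy p = uyx q"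
      using near[OF h(1,2)] by blast
    then have "\<bar>uxy p - uxy z\<bar> < d" "\<bar>uyx q - uyx z\<bar> < d" "uxy p = uyx q"
      using d1(2)[of p] d2(2)[of q] h by auto
    then have "\<bar>uxy z - uyx z\<bar> < 2 * d" by linarith
    then show False by (simp add: d_def)
  qed
qed

text \<open>The Cauchy-Riemann equations for the conjugate gradient \<open>ux - i uy\<close> of a harmonic function are
Laplace's equation and the symmetry of the mixed derivatives.\<close>
lemma has_field_derivative_gradient:
  fixes u ux uy uxx uxy uyx uyy :: "complex \<Rightarrow> real"
  assumes "(ux has_derivative (\<lambda>h. a * Re h + b * Im h)) (at z)"
    and "(uy has_derivative (\<lambda>h. b * Re h - a * Im h)) (at z)"
  shows "((\<lambda>w. Complex (ux w) (- uy w)) has_field_derivative Complex a (- b)) (at z)"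
proof -
  have "((\<lambda>w. of_real (ux w) - \<i> * of_real (uy w)) has_derivative
      (\<lambda>h. of_real (a * Re h + b * Im h) - \<i> * of_real (b * Re h - a * Im h))) (at z)"
    using assms by (auto intro!: derivative_eq_intros)
  moreover have "(\<lambda>w. complex_of_real (ux w) - \<i> * complex_of_real (uy w)) = (\<lambda>w. Complex (ux w) (- uy w))"
    by (auto simp: fun_eq_iff complex_eq_iff)
  moreover have "(\<lambda>h. complex_of_real (a * Re h + b * Im h) - \<i> * complex_of_real (b * Re h - a * Im h)) = (*) (Complex a (- b))"
    by (auto simp: fun_eq_iff complex_eq_iff algebra_simps)
  ultimately show ?thesis
    by (simp add: has_field_derivative_def)
qed

lemma harmonic_on_Re_holomorphic:
  assumes "open S" "F holomorphic_on S"
  shows "harmonic_on (\<lambda>z. Re (F z)) S"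
proof -
  have h1: "deriv F holomorphic_on S" and h2: "deriv (deriv F) holomorphic_on S"
    using assms by (auto intro: holomorphic_deriv)
  have d: "(G has_derivative (\<lambda>h. deriv G z * h)) (at z)" if "G holomorphic_on S" "z \<in> S" for G z
    using holomorphic_derivI[OF that(1) assms(1) that(2)] by (simp add: has_field_derivative_def)
  have c: "continuous_on S (deriv (deriv F))" using h2 holomorphic_on_imp_continuous_on by blast
  show ?thesis
    unfolding harmonic_on_def
  proof (intro conjI ballI assms(1), rule exI[of _ "\<lambda>z. Re (deriv F z)"], rule exI[of _ "\<lambda>z. - Im (deriv F z)"],
      rule exI[of _ "\<lambda>z. Re (deriv (deriv F) z)"], rule exI[of _ "\<lambda>z. - Im (deriv (deriv F) z)"],
      rule exI[of _ "\<lambda>z. - Im (deriv (deriv F) z)"], rule exI[of _ "\<lambda>z. - Re (deriv (deriv F) z)"],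
      intro conjI ballI)
    fix z assume z: "z \<in> S"
    show "((\<lambda>z. Re (F z)) has_derivative (\<lambda>h. Re (deriv F z) * Re h + - Im (deriv F z) * Im h)) (at z)"
      using has_derivative_Re[OF d[OF assms(2) z]] by simp
    show "((\<lambda>z. Re (deriv F z)) has_derivative (\<lambda>h. Re (deriv (deriv F) z) * Re h + - Im (deriv (deriv F) z) * Im h)) (at z)"
      using has_derivative_Re[OF d[OF h1 z]] by simp
    show "((\<lambda>z. - Im (deriv F z)) has_derivative (\<lambda>h. - Im (deriv (deriv F) z) * Re h + - Re (deriv (deriv F) z) * Im h)) (at z)"
      using has_derivative_minus[OF has_derivative_Im[OF d[OF h1 z]]] by (simp add: algebra_simps)
  qed (auto intro!: continuous_intros c)
qed

text \<open>The chain rule suggests that \<open>F\<close> should have the derivative \<open>(ux - i uy)(f z) f'(z)\<close>. This function is holomorphic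
on the disc, hence has a primitive there. Working on the disc makes the topology of \<open>S\<close> irrelevant.\<close>
lemma harmonic_compose_holomorphic_eq_Re:
  assumes u: "harmonic_on u S" and f: "f holomorphic_on ball 0 1" "f ` ball 0 1 \<subseteq> S"
  obtains F where "F holomorphic_on ball 0 1" "\<And>z. z \<in> ball 0 1 \<Longrightarrow> u (f z) = Re (F z)"
proof -
  obtain ux uy uxx uxy uyx uyy where S: "open S"
    and du: "\<And>w. w \<in> S \<Longrightarrow> (u has_derivative (\<lambda>h. ux w * Re h + uy w * Im h)) (at w)"
    and dux: "\<And>w. w \<in> S \<Longrightarrow> (ux has_derivative (\<lambda>h. uxx w * Re h + uxy w * Im h)) (at w)"
    and duy: "\<And>w. w \<in> S \<Longrightarrow> (uy has_derivative (\<lambda>h. uyx w * Re h + uyy w * Im h)) (at w)"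
    and lap: "\<And>w. w \<in> S \<Longrightarrow> uxx w + uyy w = 0"
    and cont: "continuous_on S uxy" "continuous_on S uyx"
    using u unfolding harmonic_on_def by blast
  define D where "D w = Complex (ux w) (- uy w)" for w
  have "(D has_field_derivative Complex (uxx w) (- uxy w)) (at w)" if w: "w \<in> S" for w
    unfolding D_def
  proof (rule has_field_derivative_gradient)
    show "(ux has_derivative (\<lambda>h. uxx w * Re h + uxy w * Im h)) (at w)" by (rule dux[OF w])
    have "uxy w = uyx w" "uyy w = - uxx w"
      using mixed_partials_eq[OF S w du dux duy cont] lap[OF w] by auto
    then show "(uy has_derivative (\<lambda>h. uxy w * Re h - uxx w * Im h)) (at w)"
      using duy[OF w] by simp
  qed
  then have D: "D holomorphic_on S"
    by (metis S holomorphic_on_open)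
  have "(\<lambda>z. D (f z) * deriv f z) holomorphic_on ball 0 1"
    using holomorphic_on_compose_gen[OF f(1) D f(2)] f(1)
    by (auto intro!: holomorphic_intros simp: o_def)
  then obtain F0 where F0': "\<And>z. z \<in> ball 0 1 \<Longrightarrow> (F0 has_field_derivative D (f z) * deriv f z) (at z within ball 0 1)"
    using holomorphic_convex_primitive'[of "ball 0 1" "\<lambda>z. D (f z) * deriv f z"] by auto
  then have F0: "(F0 has_field_derivative D (f z) * deriv f z) (at z)" if "z \<in> ball 0 1" for z
    using that by (metis at_within_open open_ball)
  have "((\<lambda>z. u (f z) - Re (F0 z)) has_derivative (\<lambda>h. 0)) (at z)" if z: "z \<in> ball 0 1" for z
  proof -
    have df: "(f has_derivative (\<lambda>h. deriv f z * h)) (at z)"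
      using holomorphic_derivI[OF f(1) open_ball z] by (simp add: has_field_derivative_def)
    have "f z \<in> S" using f(2) z by blast
    from has_derivative_compose[OF df du[OF this]]
    have 1: "((\<lambda>z. u (f z)) has_derivative (\<lambda>h. ux (f z) * Re (deriv f z * h) + uy (f z) * Im (deriv f z * h))) (at z)" .
    have 2: "((\<lambda>z. Re (F0 z)) has_derivative (\<lambda>h. Re (D (f z) * deriv f z * h))) (at z)"
      using F0[OF z] by (intro has_derivative_Re) (simp add: has_field_derivative_def)
    show ?thesis
      using has_derivative_diff[OF 1 2] by (simp add: D_def algebra_simps)
  qed
  then have const: "u (f z) - Re (F0 z) = u (f 0) - Re (F0 0)" if "z \<in> ball 0 1" for z
    using has_derivative_zero_unique_connected[OF open_ball connected_ball, of 0 1 "\<lambda>z. u (f z) - Re (F0 z)" z 0] that by auto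
  show thesis
  proof (rule that[of "\<lambda>z. F0 z + of_real (u (f 0) - Re (F0 0))"])
    show "(\<lambda>z. F0 z + of_real (u (f 0) - Re (F0 0))) holomorphic_on ball 0 1"
      using F0 by (intro holomorphic_intros) (metis holomorphic_on_open open_ball)
    show "u (f z) = Re (F0 z + of_real (u (f 0) - Re (F0 0)))" if "z \<in> ball 0 1" for z
      using const[OF that] by simp
  qed
qed

text \<open>This is Cauchy's integral formula at the centre.\<close>
lemma mean_value_circle:
  assumes F: "F holomorphic_on ball 0 1" and r: "0 < r" "r < 1"
  shows "((\<lambda>t. F (of_real r * cis t)) has_integral 2 * of_real pi * F 0) {0..2*pi}"
proof -
  have "F holomorphic_on cball 0 r"
    using F r by (auto intro: holomorphic_on_subset)
  then have "((\<lambda>u. F u / (u - 0)) has_contour_integral 2 * of_real pi * \<i> * F 0) (part_circlepath 0 r 0 (2*pi))"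
    using Cauchy_integral_circlepath_simple[of F 0 r 0] r by (simp add: circlepath_def)
  then have "((\<lambda>t. F (r * cis t) / (r * cis t) * r * \<i> * cis t) has_integral 2 * of_real pi * \<i> * F 0) {0..2*pi}"
    by (subst (asm) has_contour_integral_part_circlepath_iff) auto
  then have "((\<lambda>t. F (r * cis t) * \<i>) has_integral 2 * of_real pi * \<i> * F 0) {0..2*pi}"
    using r by (simp add: field_simps)
  from has_integral_mult_right[OF this, of "-\<i>"] show ?thesis by (simp add: algebra_simps)
qed

text \<open>The means over the circles of radius \<open>r\<close> depend continuously on \<open>r\<close>, so the formula passes from
\<open>r < 1\<close> to the boundary, where \<open>v\<close> is merely continuous.\<close>
lemma mean_value_boundary:
  fixes v :: "complex \<Rightarrow> real"
  assumes v: "continuous_on (cball 0 1) v"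
    and F: "F holomorphic_on ball 0 1" "\<And>z. z \<in> ball 0 1 \<Longrightarrow> v z = Re (F z)"
  shows "integral {0..2*pi} (\<lambda>t. v (cis t)) = 2 * pi * v 0"
proof -
  define m where "m r = integral (cbox 0 (2*pi)) (\<lambda>t. v (of_real r * cis t))" for r
  have "continuous_on {0..1} m"
    unfolding m_def
    by (rule integral_continuous_on_param)
       (auto simp: case_prod_unfold norm_mult intro!: continuous_intros continuous_on_compose2[OF v])
  moreover have "m r = 2 * pi * v 0" if "r \<in> {0<..<1}" for r
  proof -
    have "((\<lambda>t. Re (F (of_real r * cis t))) has_integral Re (2 * of_real pi * F 0)) {0..2*pi}"
      using has_integral_Re[OF mean_value_circle[OF F(1), of r]] that by simp
    moreover have "v (of_real r * cis t) = Re (F (of_real r * cis t))" for t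
      using that by (intro F(2)) (auto simp: norm_mult)
    moreover have "v 0 = Re (F 0)" by (intro F(2)) auto
    ultimately show ?thesis
      unfolding m_def by (simp add: integral_unique)
  qed
  ultimately have "m 1 = 2 * pi * v 0"
    using continuous_constant_on_closure[of "{0<..<1::real}" m "2 * pi * v 0" 1] by auto
  then show ?thesis by (simp add: m_def)
qed

section \<open>Measures on the unit circle\<close>

text \<open>On the circle \<open>z * cnj z = 1\<close>, so the common factor in \<open>z P(z) * cnj (z Q(z))\<close> cancels,
and induction on both polynomials reduces to mixed terms, whose real parts may be conjugated.\<close>
lemma Re_poly_times_cnj_on_circle:
  fixes P Q :: "complex poly"
  shows "\<exists>R. \<forall>z\<in>sphere 0 1. Re (poly P z * cnj (poly Q z)) = Re (poly R z)"
proof (induction P Q rule: poly_induct2)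
  case 0
  show ?case by (rule exI[of _ 0]) simp
next
  case (pCons a P b Q)
  then obtain R where R: "\<And>z. z \<in> sphere 0 1 \<Longrightarrow> Re (poly P z * cnj (poly Q z)) = Re (poly R z)" by blast
  show ?case
  proof (intro exI ballI)
    fix z :: complex assume z: "z \<in> sphere 0 1"
    then have zz: "z * cnj z = 1" by (simp add: complex_norm_square[symmetric])
    have "poly (pCons a P) z * cnj (poly (pCons b Q) z) =
        a * cnj b + cnj (cnj a * (z * poly Q z)) + cnj b * (z * poly P z) + (z * cnj z) * (poly P z * cnj (poly Q z))"
      by (simp add: algebra_simps)
    then show "Re (poly (pCons a P) z * cnj (poly (pCons b Q) z)) =
        Re (poly ([:a * cnj b:] + smult (cnj a) (pCons 0 Q) + smult (cnj b) (pCons 0 P) + R) z)"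
      by (simp only: zz mult_1_left plus_complex.sel cnj.sel R[OF z] poly_add) (simp add: algebra_simps)
  qed
qed

text \<open>Every real polynomial in the two coordinates is a trigonometric polynomial on the circle. Closure under
products is the only nontrivial case: \<open>2 Re a Re b = Re (a b) + Re (a * cnj b)\<close>.\<close>
lemma real_polynomial_function_eq_Re_poly_on_circle:
  assumes "real_polynomial_function (p :: complex \<Rightarrow> real)"
  shows "\<exists>P. \<forall>z\<in>sphere 0 1. p z = Re (poly P z)"
  using assms
proof induction
  case (linear f)
  interpret bounded_linear f by fact
  show ?case
  proof (intro exI ballI)
    fix z :: complex
    have "f z = f (Re z *\<^sub>R 1 + Im z *\<^sub>R \<i>)"
      by (rule arg_cong[of _ _ f]) (simp add: complex_eq_iff)
    also have "\<dots> = Re z * f 1 + Im z * f \<i>"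
      by (simp add: add scaleR)
    finally show "f z = Re (poly [:0, Complex (f 1) (- f \<i>):] z)" by simp
  qed
next
  case (const c)
  show ?case by (rule exI[of _ "[:of_real c:]"]) simp
next
  case (add f g)
  then obtain P Q where "\<forall>z\<in>sphere 0 1. f z = Re (poly P z)" "\<forall>z\<in>sphere 0 1. g z = Re (poly Q z)" by blast
  then show ?case by (intro exI[of _ "P + Q"]) simp
next
  case (mult f g)
  then obtain P Q where P: "\<forall>z\<in>sphere 0 1. f z = Re (poly P z)" and Q: "\<forall>z\<in>sphere 0 1. g z = Re (poly Q z)" by blast
  obtain R where R: "\<And>z. z \<in> sphere 0 1 \<Longrightarrow> Re (poly P z * cnj (poly Q z)) = Re (poly R z)"
    using Re_poly_times_cnj_on_circle by blast
  show ?case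
  proof (intro exI ballI)
    fix z :: complex assume z: "z \<in> sphere 0 1"
    have "f z * g z = (Re (poly P z * poly Q z) + Re (poly P z * cnj (poly Q z))) / 2"
      using P Q z by (simp add: algebra_simps)
    also have "\<dots> = Re (poly (smult (1/2) (P * Q + R)) z)"
      using R[OF z] by (simp add: field_simps)
    finally show "f z * g z = Re (poly (smult (1/2) (P * Q + R)) z)" .
  qed
qed

text \<open>The indicator of a closed set is the pointwise limit of bounded continuous functions, and closed sets
generate the Borel sets.\<close>
lemma measure_eqI_integral_continuous:
  fixes M N :: "'a::metric_space measure"
  assumes "finite_measure M" "finite_measure N" "sets M = sets borel" "sets N = sets borel"
    and eq: "\<And>\<psi>::'a \<Rightarrow> real. continuous_on UNIV \<psi> \<Longrightarrow> (\<integral>x. \<psi> x \<partial>M) = (\<integral>x. \<psi> x \<partial>N)"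
  shows "M = N"
proof (rule measure_eqI_generator_eq[where E="{S. closed S}" and \<Omega>=UNIV and A="\<lambda>_. UNIV"])
  interpret M: finite_measure M by fact
  interpret N: finite_measure N by fact
  fix C :: "'a set" assume "C \<in> {S. closed S}"
  then have C: "closed C" by simp
  show "emeasure M C = emeasure N C"
  proof (cases "C = {}")
    case False
    define \<psi> where "\<psi> n x = max 0 (1 - real n * infdist x C)" for n x
    have cont: "continuous_on UNIV (\<psi> n)" for n
      unfolding \<psi>_def by (intro continuous_intros)
    have lim: "(\<lambda>n. \<psi> n x) \<longlonglongrightarrow> indicator C x" for x
    proof (cases "x \<in> C")
      case True
      then show ?thesis by (simp add: \<psi>_def)
    next
      case F: False
      then have pos: "infdist x C > 0"
        using C False infdist_pos_not_in_closed by blast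
      obtain n0 where n0: "1 < real n0 * infdist x C"
        using reals_Archimedean3[OF pos] by blast
      have "\<forall>\<^sub>F n in sequentially. \<psi> n x = 0"
        using eventually_ge_at_top[of n0]
      proof eventually_elim
        case (elim n)
        then have "real n0 * infdist x C \<le> real n * infdist x C"
          by (intro mult_right_mono) (auto simp: infdist_nonneg)
        then show ?case using n0 by (simp add: \<psi>_def)
      qed
      then show ?thesis using F by (simp add: tendsto_eventually)
    qed
    have conv: "(\<lambda>n. \<integral>x. \<psi> n x \<partial>K) \<longlonglongrightarrow> measure K C" if "finite_measure K" "sets K = sets borel" for K
    proof -
      interpret K: finite_measure K by fact
      have [measurable]: "\<psi> n \<in> borel_measurable K" for n
        using borel_measurable_continuous_onI[OF cont] that(2) by (simp cong: measurable_cong_sets)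
      have "C \<in> sets K" using C that by simp
      have "(\<lambda>n. \<integral>x. \<psi> n x \<partial>K) \<longlonglongrightarrow> (\<integral>x. indicator C x \<partial>K)"
      proof (rule integral_dominated_convergence[where w="\<lambda>_. 1"])
        show "AE x in K. norm (\<psi> n x) \<le> 1" for n
          by (auto simp: \<psi>_def infdist_nonneg)
      qed (use lim \<open>C \<in> sets K\<close> in auto)
      then show ?thesis using \<open>C \<in> sets K\<close> sets.sets_into_space[OF \<open>C \<in> sets K\<close>] by (simp add: Int_absorb2)
    qed
    have "measure M C = measure N C"
      using LIMSEQ_unique[OF conv[of M] ] conv[of N] assms by (simp add: eq[OF cont])
    then show ?thesis by (simp add: M.emeasure_eq_measure N.emeasure_eq_measure)
  qed simp
next
  show "sets M = sigma_sets UNIV {S. closed S}" "sets N = sigma_sets UNIV {S. closed S}"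
    using assms(3,4) by (simp_all add: borel_eq_closed)
  show "emeasure M UNIV \<noteq> \<infinity>"
    using assms(1) by (simp add: finite_measure.emeasure_finite)
qed (auto simp: Int_stable_def)

text \<open>By the Stone-Weierstrass theorem, the real parts of complex polynomials are uniformly dense among the continuous
functions on the circle, so their integrals determine the measure.\<close>
lemma circle_measure_eqI:
  fixes M N :: "complex measure"
  assumes M: "finite_measure M" "sets M = sets borel" "AE z in M. norm z = 1"
    and N: "finite_measure N" "sets N = sets borel" "AE z in N. norm z = 1"
    and eq: "\<And>P. (\<integral>z. Re (poly P z) \<partial>M) = (\<integral>z. Re (poly P z) \<partial>N)"
  shows "M = N"
proof (rule measure_eqI_integral_continuous)
  fix \<psi> :: "complex \<Rightarrow> real" assume \<psi>: "continuous_on UNIV \<psi>"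
  define m where "m = measure M (space M) + measure N (space N)"
  have m: "m \<ge> 0" by (simp add: m_def)
  have appr: "\<bar>(\<integral>z. \<psi> z \<partial>K) - (\<integral>z. Re (poly P z) \<partial>K)\<bar> \<le> e * measure K (space K)"
    if K: "finite_measure K" "sets K = sets borel" "AE z in K. norm z = 1"
      and P: "\<And>z. z \<in> sphere 0 1 \<Longrightarrow> \<bar>\<psi> z - Re (poly P z)\<bar> < e" for K P e
  proof -
    interpret K: finite_measure K by fact
    have int: "integrable K \<phi>" if "continuous_on UNIV \<phi>" for \<phi> :: "complex \<Rightarrow> real"
    proof -
      have "bounded (\<phi> ` sphere 0 1)"
        by (intro compact_imp_bounded compact_continuous_image continuous_on_subset[OF that]) auto
      then obtain B where B: "\<And>z. z \<in> sphere 0 1 \<Longrightarrow> norm (\<phi> z) \<le> B"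
        unfolding bounded_iff by (metis imageI that)
      have "AE z in K. norm (\<phi> z) \<le> B"
        using K(3) by eventually_elim (use B in auto)
      moreover have "\<phi> \<in> borel_measurable K"
        using borel_measurable_continuous_onI[OF that] K(2) by (simp cong: measurable_cong_sets)
      ultimately show ?thesis by (rule K.integrable_const_bound)
    qed
    have i: "integrable K \<psi>" "integrable K (\<lambda>z. Re (poly P z))"
      by (intro int \<psi> continuous_intros)+
    have "\<bar>(\<integral>z. \<psi> z \<partial>K) - (\<integral>z. Re (poly P z) \<partial>K)\<bar> = \<bar>\<integral>z. \<psi> z - Re (poly P z) \<partial>K\<bar>"
      using i by simp
    also have "\<dots> \<le> (\<integral>z. \<bar>\<psi> z - Re (poly P z)\<bar> \<partial>K)" by (rule integral_abs_bound)
    also have "\<dots> \<le> (\<integral>z. e \<partial>K)"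
    proof (rule integral_mono_AE)
      show "AE z in K. \<bar>\<psi> z - Re (poly P z)\<bar> \<le> e"
        using K(3) by eventually_elim (use P in \<open>auto simp: less_imp_le\<close>)
    qed (use i in auto)
    finally show ?thesis by (simp add: mult.commute)
  qed
  have "\<bar>(\<integral>z. \<psi> z \<partial>M) - (\<integral>z. \<psi> z \<partial>N)\<bar> \<le> 0 + e" if e: "e > 0" for e
  proof -
    define d where "d = e / (m + 1)"
    have d: "d > 0" using e m by (simp add: d_def)
    obtain p where p: "real_polynomial_function p" "\<And>z. z \<in> sphere 0 1 \<Longrightarrow> \<bar>\<psi> z - p z\<bar> < d"
      using Stone_Weierstrass_real_polynomial_function[of "sphere 0 1" \<psi> d] continuous_on_subset[OF \<psi>] d by auto
    obtain P where P: "\<And>z. z \<in> sphere 0 1 \<Longrightarrow> p z = Re (poly P z)"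
      using real_polynomial_function_eq_Re_poly_on_circle[OF p(1)] by blast
    have P': "\<bar>\<psi> z - Re (poly P z)\<bar> < d" if "z \<in> sphere 0 1" for z using p(2)[OF that] P[OF that] by simp
    have "\<bar>(\<integral>z. \<psi> z \<partial>M) - (\<integral>z. \<psi> z \<partial>N)\<bar> \<le> d * m"
      using appr[OF M P'] appr[OF N P'] eq[of P] by (simp add: m_def algebra_simps)
    also have "\<dots> \<le> e" using e m by (simp add: d_def field_simps)
    finally show ?thesis by simp
  qed
  then have "\<bar>(\<integral>z. \<psi> z \<partial>M) - (\<integral>z. \<psi> z \<partial>N)\<bar> \<le> 0" by (rule field_le_epsilon)
  then show "(\<integral>z. \<psi> z \<partial>M) = (\<integral>z. \<psi> z \<partial>N)" by simp
qed (use M N in auto)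

abbreviation uniform_angle :: "real measure" where
  "uniform_angle \<equiv> uniform_measure lborel {0..2*pi}"

lemma integral_uniform_angle:
  fixes v :: "real \<Rightarrow> real"
  assumes "continuous_on UNIV v"
  shows "(\<integral>t. v t \<partial>uniform_angle) = integral {0..2*pi} v / (2*pi)"
proof -
  have [measurable]: "v \<in> borel_measurable borel" using assms borel_measurable_continuous_onI by blast
  have eq: "(\<integral>t. indicator {0..2*pi} t *\<^sub>R v t \<partial>lborel) = integral {0..2*pi} v"
    using set_borel_integral_eq_integral(2)[OF borel_integrable_atLeastAtMost'[OF continuous_on_subset[OF assms]], of 0 "2*pi"]
    by (simp add: set_lebesgue_integral_def)
  have "uniform_angle = density lborel (\<lambda>x. ennreal (indicator {0..2*pi} x / (2*pi)))"
    unfolding uniform_measure_def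
    by (intro density_cong) (auto simp: indicator_def ennreal_1[symmetric] divide_ennreal simp del: ennreal_1)
  then have "(\<integral>t. v t \<partial>uniform_angle) = (\<integral>t. (indicator {0..2*pi} t / (2*pi)) *\<^sub>R v t \<partial>lborel)"
    by (simp add: integral_density)
  also have "\<dots> = (\<integral>t. (indicator {0..2*pi} t *\<^sub>R v t) / (2*pi) \<partial>lborel)"
    by (simp add: field_simps)
  also have "\<dots> = integral {0..2*pi} v / (2*pi)"
    by (simp only: integral_divide_zero eq)
  finally show ?thesis .
qed

lemma prob_space_uniform_angle: "prob_space uniform_angle"
  by (rule prob_space_uniform_measure) auto

section \<open>Harmonic measure of a conformal image of the disc\<close>

lemma
  fixes f :: "complex \<Rightarrow> complex"
  assumes cont: "continuous_on (cball 0 1) f" and inj: "inj_on f (cball 0 1)"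
    and holo: "f holomorphic_on ball 0 1"
  shows closure_conformal_image: "closure (f ` ball 0 1) = f ` cball 0 1"
    and frontier_conformal_image: "frontier (f ` ball 0 1) = f ` sphere 0 1"
    and open_conformal_image: "open (f ` ball 0 1)"
proof -
  show op: "open (f ` ball 0 1)"
    by (rule open_mapping_thm3[OF holo]) (use inj_on_subset[OF inj] in auto)
  have "compact (f ` cball 0 1)" using cont by (intro compact_continuous_image) auto
  then have "closure (f ` ball 0 1) \<subseteq> f ` cball 0 1"
    by (intro closure_minimal image_mono compact_imp_closed) auto
  moreover have "f ` cball 0 1 \<subseteq> closure (f ` ball 0 1)"
    using image_closure_subset[OF _ closed_closure closure_subset, of "ball 0 1" f] cont by simp
  ultimately show cl: "closure (f ` ball 0 1) = f ` cball 0 1" by simp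
  have "frontier (f ` ball 0 1) = f ` cball 0 1 - f ` ball 0 1"
    using op by (simp add: frontier_def cl interior_open)
  also have "\<dots> = f ` (cball 0 1 - ball 0 1)"
    using inj by (intro inj_on_image_set_diff[symmetric]) auto
  also have "cball 0 1 - ball 0 1 = (sphere 0 1 :: complex set)" by auto
  finally show "frontier (f ` ball 0 1) = f ` sphere 0 1" .
qed

text \<open>Arc length is transported to the boundary by \<open>f\<close>. Conversely a measure with the defining property of
harmonic measure is transported to the circle by the inverse \<open>w\<close> of \<open>f\<close>; testing it against the
harmonic functions \<open>Re (P (w \<zeta>))\<close> shows that the result does not depend on the measure.\<close>
lemma is_harmonic_measure_conformal_image_iff:
  fixes f :: "complex \<Rightarrow> complex"
  assumes cont: "continuous_on (cball 0 1) f" and inj: "inj_on f (cball 0 1)"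
    and holo: "f holomorphic_on ball 0 1"
  shows "is_harmonic_measure (f 0) (f ` ball 0 1) \<mu> \<longleftrightarrow> \<mu> = distr uniform_angle borel (\<lambda>t. f (cis t))"
proof -
  define \<Omega> where "\<Omega> = f ` ball 0 1"
  define \<mu>0 where "\<mu>0 = distr uniform_angle borel (\<lambda>t. f (cis t))"
  have clo: "closure \<Omega> = f ` cball 0 1" and fro: "frontier \<Omega> = f ` sphere 0 1" and op: "open \<Omega>"
    using closure_conformal_image[OF assms] frontier_conformal_image[OF assms] open_conformal_image[OF assms]
    by (simp_all add: \<Omega>_def)
  have fro_borel [measurable]: "frontier \<Omega> \<in> sets borel" by (simp add: frontier_closed)
  interpret U: prob_space uniform_angle by (rule prob_space_uniform_angle)
  have contc: "continuous_on UNIV (\<lambda>t. f (cis t))"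
    by (rule continuous_on_compose2[OF cont]) (auto intro!: continuous_intros)
  then have [measurable]: "(\<lambda>t. f (cis t)) \<in> borel_measurable borel"
    by (rule borel_measurable_continuous_onI)
  have cis_fro: "f (cis t) \<in> frontier \<Omega>" for t by (auto simp: fro)
  have exist: "is_harmonic_measure (f 0) \<Omega> \<mu>0"
    unfolding is_harmonic_measure_def
  proof (intro conjI allI impI)
    show "sets \<mu>0 = sets borel" by (simp add: \<mu>0_def)
    show "prob_space \<mu>0" unfolding \<mu>0_def by (intro U.prob_space_distr) simp
    show "emeasure \<mu>0 (- frontier \<Omega>) = 0"
      using cis_fro by (simp add: \<mu>0_def emeasure_distr vimage_def)
    fix u assume u: "continuous_on (closure \<Omega>) u \<and> harmonic_on u \<Omega>"
    define v where "v z = u (f z)" for z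
    have v: "continuous_on (cball 0 1) v"
      unfolding v_def by (rule continuous_on_compose2[OF conjunct1[OF u] cont]) (simp add: clo)
    obtain F where F: "F holomorphic_on ball 0 1" "\<And>z. z \<in> ball 0 1 \<Longrightarrow> v z = Re (F z)"
      using harmonic_compose_holomorphic_eq_Re[OF conjunct2[OF u] holo] by (auto simp: \<Omega>_def v_def)
    have u_meas: "(\<lambda>\<zeta>. indicator (frontier \<Omega>) \<zeta> *\<^sub>R u \<zeta>) \<in> borel_measurable borel"
      using u by (intro borel_measurable_continuous_on_indicator) (auto intro: continuous_on_subset simp: frontier_def)
    have "(LINT \<zeta>:frontier \<Omega>|\<mu>0. u \<zeta>) = (\<integral>t. v (cis t) \<partial>uniform_angle)"
      using u_meas cis_fro by (simp add: set_lebesgue_integral_def \<mu>0_def integral_distr v_def)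
    also have "\<dots> = integral {0..2*pi} (\<lambda>t. v (cis t)) / (2 * pi)"
      by (intro integral_uniform_angle continuous_on_compose2[OF v]) (auto intro!: continuous_intros)
    also have "\<dots> = u (f 0)"
      using mean_value_boundary[OF v F] by (simp add: v_def)
    finally show "(LINT \<zeta>:frontier \<Omega>|\<mu>0. u \<zeta>) = u (f 0)" .
  qed
  obtain w where w: "homeomorphism (cball 0 1) (f ` cball 0 1) f w"
    using homeomorphism_compact[OF compact_cball cont refl inj] by blast
  have wf: "w (f z) = z" if "z \<in> cball 0 1" for z using w that by (auto simp: homeomorphism_def)
  have wcont: "continuous_on (closure \<Omega>) w" using w by (simp add: homeomorphism_def clo)
  obtain g where g: "g holomorphic_on \<Omega>" "\<And>z. z \<in> ball 0 1 \<Longrightarrow> g (f z) = z"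
    using holomorphic_has_inverse[OF holo open_ball inj_on_subset[OF inj]] unfolding \<Omega>_def by (metis ball_subset_cball)
  have wholo: "w holomorphic_on \<Omega>"
    using g(1) by (rule holomorphic_transform) (auto simp: \<Omega>_def g(2) wf)
  \<comment> \<open>Off the frontier, a null set, the inverse is replaced by a value on the circle.\<close>
  define h where "h \<zeta> = (if \<zeta> \<in> frontier \<Omega> then w \<zeta> else 1)" for \<zeta>
  have h_meas [measurable]: "h \<in> borel_measurable borel"
    unfolding h_def
    by (intro borel_measurable_continuous_on_if continuous_on_subset[OF wcont])
       (auto simp: frontier_def frontier_closed)
  have h_sphere: "h \<zeta> \<in> sphere 0 1" for \<zeta>
    by (auto simp: h_def fro wf)
  define k where "k z = f (if z \<in> sphere 0 1 then z else 1)" for z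
  have k_meas [measurable]: "k \<in> borel_measurable borel"
  proof -
    have "(\<lambda>z. if z \<in> sphere 0 1 then f z else f 1) \<in> borel_measurable borel"
      by (intro borel_measurable_continuous_on_if continuous_on_subset[OF cont]) auto
    also have "(\<lambda>z. if z \<in> sphere 0 1 then f z else f 1) = k" by (auto simp: k_def)
    finally show ?thesis .
  qed
  have support: "sets \<mu> = sets borel" "AE \<zeta> in \<mu>. \<zeta> \<in> frontier \<Omega>"
    if \<mu>: "is_harmonic_measure (f 0) \<Omega> \<mu>" for \<mu>
  proof -
    show sets: "sets \<mu> = sets borel" using \<mu> by (simp add: is_harmonic_measure_def)
    show "AE \<zeta> in \<mu>. \<zeta> \<in> frontier \<Omega>"
      using \<mu> by (intro AE_I'[of "- frontier \<Omega>"]) (auto simp: is_harmonic_measure_def null_sets_def)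
  qed
  have integral_h: "(\<integral>z. Re (poly P z) \<partial>distr \<mu> borel h) = Re (poly P 0)"
    if \<mu>: "is_harmonic_measure (f 0) \<Omega> \<mu>" for \<mu> P
  proof -
    have sets: "sets \<mu> = sets borel" and ae: "AE \<zeta> in \<mu>. \<zeta> \<in> frontier \<Omega>"
      using support[OF \<mu>] .
    have cont: "continuous_on (closure \<Omega>) (\<lambda>\<zeta>. Re (poly P (w \<zeta>)))"
      by (intro continuous_intros wcont)
    have harm: "harmonic_on (\<lambda>\<zeta>. Re (poly P (w \<zeta>))) \<Omega>"
      by (intro harmonic_on_Re_holomorphic op holomorphic_intros wholo)
    have *: "(\<lambda>z. Re (poly P z)) \<in> borel_measurable borel"
      by (intro borel_measurable_continuous_onI continuous_intros)
    have "h \<in> \<mu> \<rightarrow>\<^sub>M borel" using h_meas sets by (simp cong: measurable_cong_sets)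
    then have "(\<integral>z. Re (poly P z) \<partial>distr \<mu> borel h) = (\<integral>\<zeta>. Re (poly P (h \<zeta>)) \<partial>\<mu>)"
      by (rule integral_distr[OF _ *])
    also have "\<dots> = (LINT \<zeta>:frontier \<Omega>|\<mu>. Re (poly P (w \<zeta>)))"
    proof -
      have 1: "(\<lambda>\<zeta>. Re (poly P (h \<zeta>))) \<in> borel_measurable \<mu>"
        using measurable_compose[OF h_meas *] sets by (simp cong: measurable_cong_sets)
      have 2: "(\<lambda>\<zeta>. indicator (frontier \<Omega>) \<zeta> *\<^sub>R Re (poly P (w \<zeta>))) \<in> borel_measurable \<mu>"
        using borel_measurable_continuous_on_indicator[OF fro_borel continuous_on_subset[OF cont]] sets
        by (simp add: frontier_def cong: measurable_cong_sets)
      show ?thesis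
        unfolding set_lebesgue_integral_def
        by (rule integral_cong_AE[OF 1 2]) (use ae in eventually_elim, simp add: h_def)
    qed
    also have "\<dots> = Re (poly P (w (f 0)))"
      using \<mu> cont harm unfolding is_harmonic_measure_def by blast
    finally show ?thesis by (simp add: wf)
  qed
  have unique: "\<mu> = \<nu>" if \<mu>: "is_harmonic_measure (f 0) \<Omega> \<mu>" and \<nu>: "is_harmonic_measure (f 0) \<Omega> \<nu>" for \<mu> \<nu>
  proof -
    have fin: "finite_measure (distr \<mu> borel h)" "AE z in distr \<mu> borel h. norm z = 1"
      if "is_harmonic_measure (f 0) \<Omega> \<mu>" for \<mu>
    proof -
      have "prob_space \<mu>" "sets \<mu> = sets borel" using that by (auto simp: is_harmonic_measure_def)
      then interpret prob_space \<mu> by simp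
      have [measurable]: "h \<in> \<mu> \<rightarrow>\<^sub>M borel" using h_meas \<open>sets \<mu> = sets borel\<close> by (simp cong: measurable_cong_sets)
      show "finite_measure (distr \<mu> borel h)"
        using prob_space_distr[of h borel] by (simp add: prob_space.finite_measure)
      show "AE z in distr \<mu> borel h. norm z = 1"
        using h_sphere by (subst AE_distr_iff) auto
    qed
    have "distr \<mu> borel h = distr \<nu> borel h"
      by (rule circle_measure_eqI) (use fin \<mu> \<nu> integral_h in auto)
    moreover have recover: "distr (distr \<mu> borel h) borel k = \<mu>" if \<mu>: "is_harmonic_measure (f 0) \<Omega> \<mu>" for \<mu>
    proof -
      have sets: "sets \<mu> = sets borel" and ae: "AE \<zeta> in \<mu>. \<zeta> \<in> frontier \<Omega>"
        using support[OF \<mu>] .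
      have [measurable]: "h \<in> \<mu> \<rightarrow>\<^sub>M borel" using h_meas sets by (simp cong: measurable_cong_sets)
      have "distr (distr \<mu> borel h) borel k = distr \<mu> borel (\<lambda>\<zeta>. k (h \<zeta>))"
        by (simp add: distr_distr o_def)
      also have "\<dots> = distr \<mu> borel (\<lambda>\<zeta>. \<zeta>)"
      proof (rule distr_cong_AE)
        show "AE \<zeta> in \<mu>. k (h \<zeta>) = \<zeta>"
          using ae by eventually_elim (auto simp: h_def k_def fro wf)
        show "(\<lambda>\<zeta>. \<zeta>) \<in> \<mu> \<rightarrow>\<^sub>M borel" using sets by (simp add: measurable_ident_sets)
      qed simp_all
      also have "\<dots> = \<mu>" using sets by (simp add: distr_id2)
      finally show ?thesis .
    qed
    ultimately show ?thesis using \<mu> \<nu> by metis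
  qed
  show ?thesis
    using exist unique unfolding \<Omega>_def \<mu>0_def by blast
qed

section \<open>Injectivity and star-shaped images\<close>

text \<open>The Noshiro-Warschawski criterion. Along the segment from \<open>a\<close> to \<open>b\<close>, the real part of
\<open>f / (b - a)\<close> has the derivative \<open>Re f' > 0\<close>, so it is strictly increasing.\<close>
lemma inj_on_if_Re_deriv_pos:
  fixes f :: "complex \<Rightarrow> complex"
  assumes S: "convex S"
    and der: "\<And>z. z \<in> S \<Longrightarrow> (f has_field_derivative f' z) (at z)"
    and pos: "\<And>z. z \<in> S \<Longrightarrow> 0 < Re (f' z)"
  shows "inj_on f S"
proof (rule inj_onI, rule ccontr)
  fix a b assume ab: "a \<in> S" "b \<in> S" "f a = f b" "a \<noteq> b"
  define d where "d = b - a"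
  have d: "d \<noteq> 0" using ab by (simp add: d_def)
  define k where "k x = Re (f (a + of_real x * d) / d)" for x :: real
  have mem: "a + of_real x * d \<in> S" if "0 \<le> x" "x \<le> 1" for x :: real
  proof -
    have "(1 - x) *\<^sub>R a + x *\<^sub>R b \<in> S"
      using convexD[OF S ab(1,2), of "1 - x" x] that by simp
    then show ?thesis by (simp add: d_def scaleR_conv_of_real algebra_simps)
  qed
  have dk: "(k has_real_derivative Re (f' (a + of_real x * d))) (at x)" if "0 \<le> x" "x \<le> 1" for x
  proof -
    have "((\<lambda>w. f (a + w * d) / d) has_field_derivative (f' (a + of_real x * d) * d) / d) (at (of_real x))"
      by (rule DERIV_cdivide, rule DERIV_chain2[where g="\<lambda>w. a + w * d"])
         (auto intro!: derivative_eq_intros der mem that)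
    then have "((\<lambda>w. f (a + w * d) / d) has_field_derivative f' (a + of_real x * d)) (at (of_real x))"
      using d by simp
    from has_vector_derivative_real_field[OF this]
    have "((\<lambda>x. f (a + of_real x * d) / d) has_vector_derivative f' (a + of_real x * d)) (at x)" .
    from bounded_linear.has_vector_derivative[OF bounded_linear_Re this] show ?thesis
      unfolding k_def by (simp add: has_real_derivative_iff_has_vector_derivative)
  qed
  have "k 0 < k 1"
  proof (rule DERIV_pos_imp_increasing[where f=k and a=0 and b=1])
    fix x :: real assume "0 \<le> x" "x \<le> 1"
    then show "\<exists>y. (k has_real_derivative y) (at x) \<and> 0 < y" using dk pos mem by blast
  qed simp
  then show False using ab by (simp add: k_def d_def)
qed

text \<open>Only an interior point \<open>a\<close> and a boundary point \<open>b\<close> could have the same image. By the open mapping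
theorem, points close to \<open>b\<close> in the open disc would then have images that are also attained close to \<open>a\<close>,
contradicting injectivity in the open disc.\<close>
lemma inj_on_cball_if_inj_on_ball_sphere:
  fixes f :: "complex \<Rightarrow> complex"
  assumes cont: "continuous_on (cball 0 1) f" and holo: "f holomorphic_on ball 0 1"
    and inj: "inj_on f (ball 0 1)" "inj_on f (sphere 0 1)"
  shows "inj_on f (cball 0 1)"
proof -
  have disj: "f a \<noteq> f b" if a: "a \<in> ball 0 1" and b: "b \<in> sphere 0 1" for a b
  proof
    assume eq: "f a = f b"
    define d where "d = (1 - cmod a) / 2"
    have d: "d > 0" using a by (simp add: d_def)
    have sub: "ball a d \<subseteq> ball 0 1"
    proof
      fix x assume "x \<in> ball a d"
      then have "cmod x < cmod a + d"
        using norm_triangle_ineq2[of x a] by (simp add: dist_norm norm_minus_commute)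
      then show "x \<in> ball 0 1" using d by (simp add: d_def field_simps)
    qed
    have "open (f ` ball a d)"
      by (rule open_mapping_thm3) (use holo inj sub in \<open>auto intro: holomorphic_on_subset inj_on_subset\<close>)
    moreover have "f b \<in> f ` ball a d" using d eq by (metis centre_in_ball imageI)
    ultimately obtain e where e: "e > 0" "ball (f b) e \<subseteq> f ` ball a d" by (meson openE)
    obtain e' where e': "e' > 0" "\<And>x. x \<in> cball 0 1 \<Longrightarrow> dist x b < e' \<Longrightarrow> dist (f x) (f b) < e"
      using cont b e(1) unfolding continuous_on_iff by (metis mem_sphere_0 mem_cball_0 order_refl)
    define t where "t = min (e' / 2) (d / 2)"
    have dle: "d \<le> 1/2" using a by (simp add: d_def)
    have t: "0 < t" "t < e'" "t < d" "t < 1" using e' d dle by (auto simp: t_def)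
    \<comment> \<open>\<open>t < d\<close> keeps \<open>x\<close> farther from \<open>0\<close> than every point of \<open>ball a d\<close>.\<close>
    define x where "x = of_real (1 - t) * b"
    have nx: "cmod x = 1 - t" using b t by (simp add: x_def norm_mult del: of_real_diff)
    have "x - b = of_real (- t) * b" by (simp add: x_def algebra_simps)
    then have "dist x b = t" using b t by (simp add: dist_norm norm_mult del: of_real_minus)
    then have "f x \<in> ball (f b) e" using e'(2)[of x] nx t by (simp add: dist_commute)
    then obtain y where y: "y \<in> ball a d" "f x = f y" using e(2) by blast
    have "x = y" using inj(1) y sub nx t by (auto simp: inj_on_def)
    then have "cmod x < cmod a + d"
      using y(1) norm_triangle_ineq2[of x a] by (simp add: dist_norm norm_minus_commute)
    then have "1 - t < 1 - d" using nx by (simp add: d_def field_simps)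
    then show False using t by simp
  qed
  show ?thesis
  proof (rule inj_onI)
    fix x y :: complex assume xy: "x \<in> cball 0 1" "y \<in> cball 0 1" "f x = f y"
    then show "x = y"
      using disj[of x y] disj[of y x] inj by (cases "cmod x = 1"; cases "cmod y = 1") (auto simp: inj_on_def)
  qed
qed

definition star_domain :: "(real \<Rightarrow> real) \<Rightarrow> complex set" where
  "star_domain \<rho> = {rcis r \<theta> | r \<theta>. 0 \<le> r \<and> r < \<rho> \<theta> \<and> 0 \<le> \<theta> \<and> \<theta> \<le> 2*pi}"

text \<open>Two angles in \<open>[0, 2\<pi>]\<close> describing the same direction are equal or are the two end points,
where \<open>\<rho>\<close> takes the same value.\<close>
lemma polar_form_cong:
  assumes \<rho>: "\<rho> 0 = \<rho> (2*pi)"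
    and \<theta>: "\<theta> \<in> {0..2*pi}" "\<theta>' \<in> {0..2*pi}" and r: "0 \<le> r" "0 < r'" and eq: "rcis r \<theta> = rcis r' \<theta>'"
  shows "r = r'" "\<rho> \<theta> = \<rho> \<theta>'" "\<theta> < 2*pi \<Longrightarrow> \<theta>' < 2*pi \<Longrightarrow> \<theta> = \<theta>'"
proof -
  have "cmod (rcis r \<theta>) = cmod (rcis r' \<theta>')" using eq by simp
  then show rr: "r = r'" using r by simp
  have "cis \<theta> = cis \<theta>'" using eq r rr by (simp add: rcis_def)
  then have "sin \<theta> = sin \<theta>' \<and> cos \<theta> = cos \<theta>'" by (simp add: complex_eq_iff)
  then obtain n :: int where n: "\<theta> = \<theta>' + 2 * pi * n"
    by (auto simp: sin_cos_eq_iff)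
  have "\<bar>2 * pi * n\<bar> \<le> 2 * pi" using n \<theta> by auto
  then have "\<bar>real_of_int n\<bar> \<le> 1" by (simp add: abs_mult)
  then have "n \<in> {-1, 0, 1}" by auto
  then have "\<theta> = \<theta>' \<or> (\<theta> = 0 \<and> \<theta>' = 2*pi) \<or> (\<theta> = 2*pi \<and> \<theta>' = 0)"
    using n \<theta> by auto
  then show "\<rho> \<theta> = \<rho> \<theta>'" "\<theta> < 2*pi \<Longrightarrow> \<theta>' < 2*pi \<Longrightarrow> \<theta> = \<theta>'" using \<rho> by auto
qed

text \<open>The image of the disc is a bounded open set containing \<open>0\<close> whose frontier is the curve
\<open>|w| = \<rho>(arg w)\<close>. A radial segment from \<open>0\<close> that stays inside the curve cannot leave the image, and a radial half-line
outside the curve cannot meet it, since either would have to cross the frontier.\<close>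
lemma conformal_image_eq_star_domain:
  fixes f :: "complex \<Rightarrow> complex"
  assumes cont: "continuous_on (cball 0 1) f" and holo: "f holomorphic_on ball 0 1"
    and inj: "inj_on f (cball 0 1)" and f0: "f 0 = 0"
    and \<rho>: "\<And>\<theta>. \<theta> \<in> {0..2*pi} \<Longrightarrow> 0 < \<rho> \<theta>" "\<rho> 0 = \<rho> (2*pi)"
    and bd: "f ` sphere 0 1 = (\<lambda>\<theta>. rcis (\<rho> \<theta>) \<theta>) ` {0..2*pi}"
  shows "f ` ball 0 1 = star_domain \<rho>"
proof -
  let ?D = "f ` ball 0 1"
  have fro: "frontier ?D = (\<lambda>\<theta>. rcis (\<rho> \<theta>) \<theta>) ` {0..2*pi}"
    using frontier_conformal_image[OF cont inj holo] bd by simp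
  have op: "open ?D" by (rule open_conformal_image[OF cont inj holo])
  have conn: "connected ?D"
    by (intro connected_continuous_image continuous_on_subset[OF cont]) auto
  have zero: "0 \<in> ?D" using f0 by (metis centre_in_ball imageI zero_less_one)
  have "bounded (f ` cball 0 1)"
    by (intro compact_imp_bounded compact_continuous_image cont) auto
  then have "bounded ?D" by (rule bounded_subset) auto
  then obtain B where B: "\<And>x. x \<in> ?D \<Longrightarrow> cmod x \<le> B" by (auto simp: bounded_iff)
  have on_bd: "r = \<rho> \<theta>" if rt: "rcis r \<theta> \<in> frontier ?D" "0 \<le> r" "\<theta> \<in> {0..2*pi}" for r \<theta>
  proof -
    obtain \<theta>' where t': "\<theta>' \<in> {0..2*pi}" "rcis r \<theta> = rcis (\<rho> \<theta>') \<theta>'"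
      using rt(1) unfolding fro by blast
    show ?thesis
      using polar_form_cong(1,2)[OF \<rho>(2) rt(3) t'(1) rt(2) \<rho>(1)[OF t'(1)] t'(2)] by simp
  qed
  have polar: "\<exists>r \<theta>. z = rcis r \<theta> \<and> 0 \<le> r \<and> \<theta> \<in> {0..2*pi}" for z
    using Arg2pi[of z] by (intro exI[of _ "cmod z"] exI[of _ "Arg2pi z"]) (auto simp: is_Arg_def rcis_def cis_conv_exp)
  have ray: "connected ((\<lambda>t. rcis t \<theta>) ` A)" if "connected A" for \<theta> A
    using that by (intro connected_continuous_image) (auto simp: rcis_def intro!: continuous_intros)
  show ?thesis
  proof (intro equalityI subsetI)
    fix z assume "z \<in> star_domain \<rho>"
    then obtain r \<theta> where z: "z = rcis r \<theta>" "0 \<le> r" "r < \<rho> \<theta>" "\<theta> \<in> {0..2*pi}"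
      by (auto simp: star_domain_def)
    show "z \<in> ?D"
    proof (rule ccontr)
      assume "z \<notin> ?D"
      have "(\<lambda>t. rcis t \<theta>) ` {0..r} \<inter> frontier ?D \<noteq> {}"
      proof (rule connected_Int_frontier[OF ray])
        show "(\<lambda>t. rcis t \<theta>) ` {0..r} \<inter> ?D \<noteq> {}" using zero z(2) by force
        have "z \<in> (\<lambda>t. rcis t \<theta>) ` {0..r}" using z by auto
        then show "(\<lambda>t. rcis t \<theta>) ` {0..r} - ?D \<noteq> {}" using \<open>z \<notin> ?D\<close> by blast
      qed auto
      then show False using on_bd z by force
    qed
  next
    fix z assume zD: "z \<in> ?D"
    obtain r \<theta> where z: "z = rcis r \<theta>" "0 \<le> r" "\<theta> \<in> {0..2*pi}" using polar by blast
    have "r < \<rho> \<theta>"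
    proof (rule ccontr)
      assume "\<not> r < \<rho> \<theta>"
      moreover have "r \<noteq> \<rho> \<theta>"
      proof
        assume "r = \<rho> \<theta>"
        then have "z \<in> frontier ?D" using z by (auto simp: fro)
        then show False using zD op by (simp add: frontier_def interior_open)
      qed
      ultimately have r: "r > \<rho> \<theta>" by simp
      have "(\<lambda>t. rcis t \<theta>) ` {r..} \<inter> frontier ?D \<noteq> {}"
      proof (rule connected_Int_frontier[OF ray])
        have "z \<in> (\<lambda>t. rcis t \<theta>) ` {r..}" using z by auto
        then show "(\<lambda>t. rcis t \<theta>) ` {r..} \<inter> ?D \<noteq> {}" using zD by blast
        have "rcis (max r (B + 1)) \<theta> \<notin> ?D" using B[of "rcis (max r (B + 1)) \<theta>"] z(2) by auto
        moreover have "rcis (max r (B + 1)) \<theta> \<in> (\<lambda>t. rcis t \<theta>) ` {r..}" by auto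
        ultimately show "(\<lambda>t. rcis t \<theta>) ` {r..} - ?D \<noteq> {}" by blast
      qed auto
      then obtain t where "t \<ge> r" "rcis t \<theta> \<in> frontier ?D" by auto
      then show False using on_bd[of t \<theta>] z r by simp
    qed
    then show "z \<in> star_domain \<rho>" using z by (auto simp: star_domain_def)
  qed
qed

section \<open>Estimates for the logarithmic kernel\<close>

text \<open>Half angles give \<open>sin u = 2 tan(u/2) cos\<^sup>2(u/2)\<close>, where \<open>|tan v| \<ge> |v|\<close> and
\<open>cos\<^sup>2(u/2) = (1 + cos u)/2 \<ge> 1/2\<close>.\<close>
lemma abs_sin_ge_half:
  fixes u :: real
  assumes "\<bar>u\<bar> \<le> pi / 2"
  shows "\<bar>u\<bar> / 2 \<le> \<bar>sin u\<bar>"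
proof -
  define v where "v = u / 2"
  have v: "\<bar>v\<bar> < pi / 2" using assms pi_gt_zero unfolding v_def by linarith
  have cv: "cos v > 0" using v by (intro cos_gt_zero_pi) auto
  have cu: "cos u \<ge> 0" using assms by (intro cos_ge_zero) auto
  have "\<bar>u\<bar> / 2 \<le> \<bar>u\<bar> * ((1 + cos u) / 2)" using cu by (simp add: algebra_simps)
  also have "(1 + cos u) / 2 = cos v ^ 2"
    using cos_double_cos[of v] by (simp add: v_def field_simps)
  also have "\<bar>u\<bar> * cos v ^ 2 \<le> (2 * \<bar>tan v\<bar>) * cos v ^ 2"
    using abs_tan_ge[OF v] by (intro mult_right_mono) (auto simp: v_def)
  also have "\<dots> = \<bar>2 * sin v * cos v\<bar>"
    using cv by (simp add: tan_def power2_eq_square abs_mult)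
  also have "\<dots> = \<bar>sin u\<bar>" using sin_double[of v] by (simp add: v_def)
  finally show ?thesis .
qed

text \<open>The left-hand side is the distance from \<open>cis (x - t)\<close> to the real axis, which contains the point \<open>r\<close>.\<close>
lemma cmod_one_minus_ge_abs_sin: "\<bar>sin (t - x)\<bar> \<le> cmod (1 - rcis r t * cis (- x))"
proof -
  have "1 - rcis r t * cis (- x) = (cis (x - t) - of_real r) * cis (t - x)"
    by (simp add: rcis_def algebra_simps cis_mult)
  then have "cmod (1 - rcis r t * cis (- x)) = cmod (cis (x - t) - of_real r)"
    by (simp add: norm_mult)
  also have "\<dots> \<ge> \<bar>Im (cis (x - t) - of_real r)\<bar>" by (rule abs_Im_le_cmod)
  finally show ?thesis by (simp add: sin_diff abs_minus_commute mult.commute)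
qed

lemma powr_minus_half: "x powr - (1/2) = 1 / sqrt x" if "x > 0" for x :: real
  using that powr_minus[of x "1/2"] by (simp add: powr_half_sqrt inverse_eq_divide)

lemma nn_integral_inverse_sqrt_finite:
  "(\<integral>\<^sup>+v. ennreal (indicator {-2..2} v * \<bar>v\<bar> powr (-1/2)) \<partial>lborel) < \<infinity>"
proof -
  define q where "q v = ennreal (indicator {0..2} v * v powr (-1/2))" for v :: real
  have [measurable]: "q \<in> borel_measurable borel" unfolding q_def by measurable
  have "((\<lambda>v. v powr (-1/2)) has_integral 2 powr (1/2) / (1/2)) {0..2::real}"
    using has_integral_powr_from_0[of "-1/2" 2] by simp
  then have "((\<lambda>v. if v \<in> {0..2} then v powr (-1/2) else 0) has_integral 2 powr (1/2) / (1/2)) (UNIV :: real set)"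
    by (subst has_integral_restrict_UNIV)
  also have "(\<lambda>v. if v \<in> {0..2} then v powr (-1/2) else 0) = (\<lambda>v. indicator {0..2} v * v powr (-1/2) :: real)"
    by (auto simp: indicator_def)
  finally have "(\<integral>\<^sup>+v. q v \<partial>lborel) = ennreal (2 powr (1/2) / (1/2))"
    unfolding q_def by (intro nn_integral_has_integral_lborel) auto
  then have fin: "(\<integral>\<^sup>+v. q v \<partial>lborel) < \<infinity>" by simp
  have "(\<integral>\<^sup>+v. ennreal (indicator {-2..2} v * \<bar>v\<bar> powr (-1/2)) \<partial>lborel) \<le> (\<integral>\<^sup>+v. q v + q (0 + (-1) * v) \<partial>lborel)"
    by (intro nn_integral_mono) (auto simp: q_def indicator_def)
  also have "\<dots> = (\<integral>\<^sup>+v. q v \<partial>lborel) + (\<integral>\<^sup>+v. q (0 + (-1) * v) \<partial>lborel)"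
    by (intro nn_integral_add) auto
  also have "(\<integral>\<^sup>+v. q (0 + (-1) * v) \<partial>lborel) = (\<integral>\<^sup>+v. q v \<partial>lborel)"
    using nn_integral_real_affine[of q "-1" 0] by simp
  finally show ?thesis using fin by (simp add: order_le_less_trans)
qed

text \<open>The kernel is dominated by \<open>|sin (x - t)|^(-1/2)\<close> with \<open>t = arg z\<close>. Near each of its at most five
singularities in the interval, \<open>|sin|\<close> is at least half the distance to the singularity, and
the integral of the inverse square root of that distance does not depend on \<open>t\<close>.\<close>
lemma circle_kernel_bound:
  obtains C where "C \<ge> 0"
    "\<And>z. z \<in> cball 0 1 \<Longrightarrow> (\<integral>\<^sup>+x. ennreal (cmod (1 - z * cis (- x)) powr (-1/2)) \<partial>uniform_angle) \<le> ennreal C"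
proof -
  define q where "q v = ennreal (indicator {-2..2} v * \<bar>v\<bar> powr (-1/2))" for v :: real
  have [measurable]: "q \<in> borel_measurable borel" unfolding q_def by measurable
  define I where "I = (\<integral>\<^sup>+v. q v \<partial>lborel)"
  have I: "I < \<infinity>" unfolding I_def q_def by (rule nn_integral_inverse_sqrt_finite)
  define C where "C = enn2real (2 * (5 * I) / ennreal (2 * pi))"
  have fin: "2 * (5 * I) / ennreal (2 * pi) < \<infinity>"
    using I by (simp add: ennreal_mult_less_top ennreal_divide_eq_top_iff less_top[symmetric] ennreal_mult_eq_top_iff)
  show thesis
  proof (rule that[of C])
    show "C \<ge> 0" by (simp add: C_def)
    fix z :: complex
    define r t where "r = cmod z" and "t = Arg2pi z"
    have z: "z = rcis r t" and t: "0 \<le> t" "t < 2 * pi"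
      using Arg2pi[of z] by (auto simp: r_def t_def is_Arg_def rcis_def cis_conv_exp)
    have pt: "ennreal (cmod (1 - z * cis (- x)) powr (-1/2)) \<le> 2 * (\<Sum>k\<in>{-2..2::int}. q ((- t - of_int k * pi) + 1 * x))"
      if x: "x \<in> {0..2*pi}" and xt: "\<And>k::int. x \<noteq> t + of_int k * pi" for x
    proof (cases "1 - z * cis (- x) = 0")
      case False
      \<comment> \<open>The zero \<open>t + k\<pi>\<close> of \<open>sin (x - t)\<close> nearest to \<open>x\<close>; it is at distance \<open>|u|\<close>.\<close>
      define k where "k = round ((x - t) / pi)"
      define u where "u = (x - t) - of_int k * pi"
      have kk: "\<bar>of_int k - (x - t) / pi\<bar> \<le> 1/2" unfolding k_def by (rule of_int_round_abs_le)
      have "u = - (of_int k - (x - t) / pi) * pi" by (simp add: u_def field_simps)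
      then have "\<bar>u\<bar> = \<bar>of_int k - (x - t) / pi\<bar> * pi" by (simp add: abs_mult)
      also have "\<dots> \<le> 1/2 * pi" using kk by (intro mult_right_mono) auto
      finally have u: "\<bar>u\<bar> \<le> pi / 2" by simp
      have "\<bar>x - t\<bar> \<le> 2 * pi" using x t by (auto simp: abs_le_iff)
      then have "\<bar>(x - t) / pi\<bar> \<le> 2" by (simp add: abs_divide field_simps)
      then have "\<bar>real_of_int k\<bar> \<le> 2 + 1/2" using kk by linarith
      then have k: "k \<in> {-2..2}" by auto
      have "\<bar>sin (t - x)\<bar> = \<bar>sin (u + of_int k * pi)\<bar>"
        using sin_minus[of "x - t"] by (simp add: u_def)
      also have "\<dots> = \<bar>sin u\<bar>"
      proof -
        have s0: "sin (of_int k * pi) = 0" by (simp add: sin_zero_iff_int2)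
        then have "(cos (of_int k * pi))\<^sup>2 = 1"
          using sin_cos_squared_add[of "of_int k * pi"] by simp
        then have "\<bar>cos (of_int k * pi)\<bar> = 1" by (auto simp: power2_eq_1_iff)
        with s0 show ?thesis by (simp add: sin_add abs_mult)
      qed
      finally have su: "\<bar>u\<bar> / 2 \<le> cmod (1 - z * cis (- x))"
        using abs_sin_ge_half[OF u] cmod_one_minus_ge_abs_sin[of t x r] z by simp
      have "pi / 2 \<le> 2" using pi_less_4 by simp
      then have u2: "\<bar>u\<bar> \<le> 2" using u by linarith
      have u0: "\<bar>u\<bar> > 0" using xt[of k] by (simp add: u_def)
      have "cmod (1 - z * cis (- x)) powr (-1/2) \<le> (\<bar>u\<bar> / 4) powr (-1/2)"
        using su u0 by (intro powr_mono2') auto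
      also have "\<dots> = 2 * (indicator {-2..2} u * \<bar>u\<bar> powr (-1/2))"
        using u0 u2 by (auto simp: powr_divide indicator_def abs_le_iff powr_minus_half)
      finally have "ennreal (cmod (1 - z * cis (- x)) powr (-1/2)) \<le> ennreal (2 * (indicator {-2..2} u * \<bar>u\<bar> powr (-1/2)))"
        by (rule ennreal_leI)
      also have "\<dots> = 2 * q ((- t - of_int k * pi) + 1 * x)"
        unfolding q_def u_def by (subst ennreal_mult) (auto simp: algebra_simps)
      also have "\<dots> \<le> 2 * (\<Sum>k\<in>{-2..2::int}. q ((- t - of_int k * pi) + 1 * x))"
        using k by (intro mult_left_mono member_le_sum) auto
      finally show ?thesis .
    qed simp
    show "(\<integral>\<^sup>+x. ennreal (cmod (1 - z * cis (- x)) powr (-1/2)) \<partial>uniform_angle) \<le> ennreal C"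
    proof -
      have [measurable]: "(\<lambda>x. ennreal (cmod (1 - z * cis (- x)) powr (-1/2))) \<in> borel_measurable borel"
      proof -
        have "(\<lambda>x. cmod (1 - z * cis (- x))) \<in> borel_measurable borel"
          by (intro borel_measurable_continuous_onI continuous_intros)
        then show ?thesis by measurable
      qed
      have "AE x in lborel. \<forall>k::int. x \<noteq> t + of_int k * pi"
        by (simp add: AE_all_countable AE_lborel_singleton)
      then have "(\<integral>\<^sup>+x. ennreal (cmod (1 - z * cis (- x)) powr (-1/2)) * indicator {0..2*pi} x \<partial>lborel)
          \<le> (\<integral>\<^sup>+x. 2 * (\<Sum>k\<in>{-2..2::int}. q ((- t - of_int k * pi) + 1 * x)) \<partial>lborel)"
      proof (intro nn_integral_mono_AE, eventually_elim)
        case (elim x)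
        then show ?case using pt[of x] by (cases "x \<in> {0..2*pi}") auto
      qed
      also have "\<dots> = 2 * (\<Sum>k\<in>{-2..2::int}. \<integral>\<^sup>+x. q ((- t - of_int k * pi) + 1 * x) \<partial>lborel)"
        by (simp add: nn_integral_cmult nn_integral_sum)
      also have "\<dots> = 2 * (\<Sum>k\<in>{-2..2::int}. I)"
      proof -
        have "(\<integral>\<^sup>+x. q ((- t - of_int k * pi) + 1 * x) \<partial>lborel) = I" for k :: int
          using nn_integral_real_affine[of q 1 "- t - of_int k * pi"] by (simp add: I_def)
        then show ?thesis by (simp only:)
      qed
      finally have "(\<integral>\<^sup>+x. ennreal (cmod (1 - z * cis (- x)) powr (-1/2)) * indicator {0..2*pi} x \<partial>lborel) \<le> 2 * (5 * I)"
        by simp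
      then have "(\<integral>\<^sup>+x. ennreal (cmod (1 - z * cis (- x)) powr (-1/2)) * indicator {0..2*pi} x \<partial>lborel) / emeasure lborel {0..2*pi}
          \<le> 2 * (5 * I) / ennreal (2 * pi)"
        by (auto intro!: divide_right_mono_ennreal)
      moreover have "(\<integral>\<^sup>+x. ennreal (cmod (1 - z * cis (- x)) powr (-1/2)) \<partial>uniform_angle) =
          (\<integral>\<^sup>+x. ennreal (cmod (1 - z * cis (- x)) powr (-1/2)) * indicator {0..2*pi} x \<partial>lborel) / emeasure lborel {0..2*pi}"
        by (rule nn_integral_uniform_measure) measurable
      ultimately have "(\<integral>\<^sup>+x. ennreal (cmod (1 - z * cis (- x)) powr (-1/2)) \<partial>uniform_angle) \<le> 2 * (5 * I) / ennreal (2 * pi)"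
        by simp
      also have "\<dots> = ennreal C" using fin by (simp add: C_def)
      finally show ?thesis .
    qed
  qed
qed

text \<open>The decisive inequality. With \<open>x = sqrt (\<epsilon>/y)\<close> it follows from \<open>1 + \<epsilon>/y \<le> (1 + x)\<^sup>2\<close> and, if
\<open>g < \<kappa>\<close>, from \<open>1 + x \<le> (\<kappa>/g) (1 + g x/\<kappa>)\<close>. The right-hand side has a small integral if first \<open>\<kappa>\<close> and
then \<open>\<epsilon>\<close> is chosen small, and its last term carries the factor \<open>g\<close>.\<close>
lemma ln_one_plus_le:
  fixes g \<kappa> \<epsilon> y :: real
  assumes "0 < g" "0 < \<kappa>" "0 < \<epsilon>" "0 < y"
  shows "ln (1 + \<epsilon> / y) \<le> 2 * (max 0 (ln \<kappa> - ln g) + sqrt \<epsilon> / \<kappa> * (g * y powr (-1/2)))"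
proof -
  define x where "x = sqrt (\<epsilon> / y)"
  have x: "x > 0" "x\<^sup>2 = \<epsilon> / y" using assms by (simp_all add: x_def)
  have xy: "x = sqrt \<epsilon> * y powr (-1/2)"
    using assms by (simp add: x_def real_sqrt_divide powr_minus_half)
  have main: "ln (1 + x) \<le> max 0 (ln \<kappa> - ln g) + g / \<kappa> * x"
  proof (cases "g \<ge> \<kappa>")
    case True
    have "ln (1 + x) \<le> x" using x by (intro ln_add_one_self_le_self) simp
    also have "\<dots> \<le> g / \<kappa> * x" using True assms x by (simp add: field_simps)
    finally show ?thesis by simp
  next
    case False
    have "1 + x \<le> \<kappa> / g * (1 + g / \<kappa> * x)" using False assms x by (simp add: field_simps)
    then have "ln (1 + x) \<le> ln (\<kappa> / g * (1 + g / \<kappa> * x))" using x assms by (subst ln_le_cancel_iff) (auto intro!: add_pos_pos mult_pos_pos)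
    also have "\<dots> = ln (\<kappa> / g) + ln (1 + g / \<kappa> * x)"
      using assms x by (intro ln_mult_pos) (auto intro!: add_pos_pos)
    also have "ln (\<kappa> / g) = ln \<kappa> - ln g" using assms by (simp add: ln_div)
    also have "ln (1 + g / \<kappa> * x) \<le> g / \<kappa> * x" using assms x by (intro ln_add_one_self_le_self) simp
    finally show ?thesis by simp
  qed
  have "1 + \<epsilon> / y \<le> (1 + x)\<^sup>2" using x by (simp add: power2_eq_square algebra_simps)
  then have "ln (1 + \<epsilon> / y) \<le> ln ((1 + x)\<^sup>2)" using assms x by (intro ln_mono) (auto intro!: add_pos_pos)
  also have "\<dots> = 2 * ln (1 + x)" using x by (simp add: ln_realpow)
  also have "\<dots> \<le> 2 * (max 0 (ln \<kappa> - ln g) + g / \<kappa> * x)" using main by simp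
  also have "g / \<kappa> * x = sqrt \<epsilon> / \<kappa> * (g * y powr (-1/2))" by (simp add: xy)
  finally show ?thesis .
qed

text \<open>The derivative of \<open>Ln (w + x)\<close> in \<open>x\<close> is \<open>1/(w + x)\<close>, and \<open>2 |w + x| \<ge> |w| + x\<close> because \<open>w\<close> lies in the
closed right half-plane.\<close>
lemma Ln_add_of_real_bound:
  assumes w: "Re w \<ge> 0" "w \<noteq> 0" and e: "\<epsilon> > 0"
  shows "cmod (Ln (w + of_real \<epsilon>) - Ln w) \<le> 2 * ln (1 + \<epsilon> / cmod w)"
proof -
  have np: "w + of_real x \<notin> \<real>\<^sub>\<le>\<^sub>0" if "x \<ge> 0" for x
    using w that by (auto simp: complex_nonpos_Reals_iff complex_eq_iff)
  have "norm (Ln (w + of_real \<epsilon>) - Ln (w + of_real 0)) \<le> 2 * ln (cmod w + \<epsilon>) - 2 * ln (cmod w + 0)"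
  proof (rule differentiable_bound_general[where f="\<lambda>x. Ln (w + of_real x)" and \<phi>="\<lambda>x. 2 * ln (cmod w + x)"
        and f'="\<lambda>x. 1 / (w + of_real x)" and \<phi>'="\<lambda>x. 2 / (cmod w + x)"])
    show "continuous_on {0..\<epsilon>} (\<lambda>x. Ln (w + of_real x))"
      by (intro continuous_intros) (use np in auto)
    show "continuous_on {0..\<epsilon>} (\<lambda>x. 2 * ln (cmod w + x))"
      by (intro continuous_intros) (use w in \<open>auto simp: add_nonneg_eq_0_iff\<close>)
    fix x assume x: "0 < x" "x < \<epsilon>"
    have "((\<lambda>c. Ln (w + c)) has_field_derivative 1 / (w + of_real x)) (at (of_real x))"
      using np[of x] x by (auto intro!: derivative_eq_intros simp: inverse_eq_divide)
    from has_vector_derivative_real_field[OF this]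
    show "((\<lambda>x. Ln (w + of_real x)) has_vector_derivative 1 / (w + of_real x)) (at x)" .
    show "((\<lambda>x. 2 * ln (cmod w + x)) has_vector_derivative 2 / (cmod w + x)) (at x)"
      unfolding has_real_derivative_iff_has_vector_derivative[symmetric]
      using x w by (auto intro!: derivative_eq_intros add_nonneg_pos simp: field_simps)
    have wx: "cmod (w + of_real x) > 0" using np[of x] x by auto
    have "cmod w ^ 2 + x ^ 2 \<le> cmod (w + of_real x) ^ 2"
      unfolding cmod_power2 using w x by (simp add: power2_eq_square algebra_simps)
    moreover have "(cmod w + x)\<^sup>2 \<le> 2 * (cmod w ^ 2 + x ^ 2)"
      using zero_le_power2[of "cmod w - x"] by (simp add: power2_eq_square algebra_simps)
    ultimately have "(cmod w + x)\<^sup>2 \<le> 2 * cmod (w + of_real x) ^ 2"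
      by (meson mult_left_mono order_trans zero_le_numeral)
    also have "\<dots> \<le> 4 * cmod (w + of_real x) ^ 2" by (intro mult_right_mono) auto
    finally have "(cmod w + x)\<^sup>2 \<le> (2 * cmod (w + of_real x))\<^sup>2" by (simp add: power_mult_distrib)
    then have "cmod w + x \<le> 2 * cmod (w + of_real x)" by (rule power2_le_imp_le) simp
    then show "norm (1 / (w + of_real x)) \<le> 2 / (cmod w + x)"
      using frac_le[of 2 2 "cmod w + x" "2 * cmod (w + of_real x)"] wx x by (simp add: norm_divide add_nonneg_pos)
  qed (use e in auto)
  also have "2 * ln (cmod w + \<epsilon>) - 2 * ln (cmod w + 0) = 2 * ln (1 + \<epsilon> / cmod w)"
  proof -
    have "1 + \<epsilon> / cmod w = (cmod w + \<epsilon>) / cmod w" using w by (simp add: field_simps)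
    moreover have "0 < cmod w + \<epsilon>" using e by (simp add: add_nonneg_pos)
    ultimately show ?thesis using w by (simp add: ln_div)
  qed
  finally show ?thesis by simp
qed

lemma Ln_add_of_real_bound':
  fixes g \<kappa> \<epsilon> :: real
  assumes "Re w \<ge> 0" "w \<noteq> 0" "0 < g" "0 < \<kappa>" "0 < \<epsilon>"
  shows "cmod (Ln (w + of_real \<epsilon>) - Ln w) \<le> 4 * max 0 (ln \<kappa> - ln g) + 4 * (sqrt \<epsilon> / \<kappa>) * (g * cmod w powr (-1/2))"
  using Ln_add_of_real_bound[OF assms(1,2,5)] ln_one_plus_le[OF assms(3,4,5), of "cmod w"] assms(2)
  by simp

text \<open>The Moebius map \<open>1/(1 - v)\<close> sends the circle of radius \<open>r\<close> to a circle that is symmetric about the real axis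
with leftmost point \<open>1/(1 + r)\<close>.\<close>
lemma Re_inverse_one_minus_ge:
  assumes "cmod v < 1"
  shows "1 / (1 + cmod v) \<le> Re (1 / (1 - v))"
proof -
  define a r where "a = Re v" and "r = cmod v"
  have r: "0 \<le> r" "r < 1" using assms by (simp_all add: r_def)
  have a: "\<bar>a\<bar> \<le> r" by (simp add: a_def r_def abs_Re_le_cmod)
  have n: "(cmod (1 - v))\<^sup>2 = 1 - 2 * a + r\<^sup>2"
    unfolding a_def r_def cmod_power2 by (simp add: power2_eq_square algebra_simps)
  have "1 - v \<noteq> 0" using assms by auto
  then have pos: "0 < 1 - 2 * a + r\<^sup>2" unfolding n[symmetric] by simp
  have "0 \<le> (r + a) * (1 - r)" using a r by simp
  then have "1 - 2 * a + r\<^sup>2 \<le> (1 - a) * (1 + r)" by (simp add: power2_eq_square algebra_simps)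
  then have "1 / (1 + r) \<le> (1 - a) / (1 - 2 * a + r\<^sup>2)"
    using pos r by (simp add: divide_le_eq le_divide_eq pos_divide_le_eq pos_le_divide_eq mult.commute)
  also have "\<dots> = Re (1 / (1 - v))"
    unfolding n[symmetric] cmod_power2 by (simp add: Re_divide a_def)
  finally show ?thesis by (simp add: r_def)
qed

text \<open>Indeed \<open>1 - exp(i x) = 2 sin(x/2) exp(i (x - \<pi>)/2)\<close>.\<close>
lemma Im_Ln_one_minus_cis:
  assumes "0 < x" "x < 2*pi"
  shows "Im (Ln (1 - cis x)) = (x - pi) / 2" "Im (Ln (1 - cis (- x))) = (pi - x) / 2"
proof -
  have half: "sin (x / 2) > 0" using assms by (intro sin_gt_zero) auto
  have key: "1 - cis y = exp (of_real (ln (2 * sin (x / 2))) + \<i> * of_real a)"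
    if "2 * sin (x / 2) * cos a = 1 - cos y" "2 * sin (x / 2) * sin a = - sin y" for a y
  proof -
    have "exp (of_real (ln (2 * sin (x / 2))) + \<i> * of_real a) = of_real (2 * sin (x / 2)) * cis a"
      using half by (simp add: exp_add exp_of_real cis_conv_exp del: of_real_mult)
    also have "\<dots> = 1 - cis y" using that by (simp add: complex_eq_iff)
    finally show ?thesis by simp
  qed
  have c: "cos x = 1 - 2 * (sin (x / 2))\<^sup>2" using cos_double_sin[of "x / 2"] by simp
  have d: "sin x = 2 * sin (x / 2) * cos (x / 2)" using sin_double[of "x / 2"] by simp
  have shift: "cos ((x - pi) / 2) = sin (x / 2)" "sin ((x - pi) / 2) = - cos (x / 2)"
    "cos ((pi - x) / 2) = sin (x / 2)" "sin ((pi - x) / 2) = cos (x / 2)"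
    by (simp_all add: diff_divide_distrib cos_diff sin_diff)
  have "1 - cis x = exp (of_real (ln (2 * sin (x / 2))) + \<i> * of_real ((x - pi) / 2))"
    by (rule key) (simp_all add: shift c d power2_eq_square)
  then show "Im (Ln (1 - cis x)) = (x - pi) / 2" using assms by (simp add: Ln_exp)
  have "1 - cis (- x) = exp (of_real (ln (2 * sin (x / 2))) + \<i> * of_real ((pi - x) / 2))"
    by (rule key) (simp_all add: shift c d power2_eq_square)
  then show "Im (Ln (1 - cis (- x))) = (pi - x) / 2" using assms by (simp add: Ln_exp)
qed

section \<open>The boundary parametrisation of a density\<close>

text \<open>The density is extended by \<open>0\<close>, which makes it the density of a probability measure on the whole line.\<close>
locale szego_density =
  fixes g :: "real \<Rightarrow> real"
  assumes g_meas [measurable]: "g \<in> borel_measurable borel"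
    and g_nonneg: "\<And>x. 0 \<le> g x"
    and g_outside: "\<And>x. x \<notin> {0..2*pi} \<Longrightarrow> g x = 0"
    and g_total: "(\<integral>\<^sup>+x. ennreal (g x) \<partial>lborel) = 1"
    and g_szego: "(\<integral>\<^sup>+x\<in>{0..2*pi}. log_minus (g x) \<partial>lborel) < \<infinity>"
begin

definition M :: "real measure" where
  "M = density lborel (\<lambda>x. ennreal (g x))"

definition s :: "real \<Rightarrow> real" where
  "s \<theta> = 2 * pi * cdf M \<theta>"

abbreviation L :: "real measure" where
  "L \<equiv> restrict_space lborel {0..2*pi}"

lemma real_distribution_M: "real_distribution M"
proof -
  have "prob_space M"
    by (rule prob_spaceI) (simp add: M_def emeasure_density g_total)
  then show ?thesis
    by (simp add: real_distribution_def real_distribution_axioms_def M_def)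
qed

sublocale M: real_distribution M by (rule real_distribution_M)

lemma sets_M [measurable_cong]: "sets M = sets borel" by (simp add: M_def)

lemma log_minus_measurable [measurable]: "log_minus \<in> borel_measurable borel"
  unfolding log_minus_def by measurable

lemma AE_g_pos: "AE x in lborel. x \<in> {0..2*pi} \<longrightarrow> 0 < g x"
proof -
  have "AE x in lborel. log_minus (g x) * indicator {0..2*pi} x \<noteq> \<infinity>"
    by (rule nn_integral_PInf_AE) (use g_szego in auto)
  then show ?thesis
    by eventually_elim (use g_nonneg in \<open>auto simp: log_minus_def less_le\<close>)
qed

lemma finite_measure_L: "finite_measure L"
  by (rule finite_measureI) (simp add: emeasure_restrict_space space_restrict_space)

sublocale L: finite_measure L by (rule finite_measure_L)

lemma AE_L_iff: "(AE x in L. P x) \<longleftrightarrow> (AE x in lborel. x \<in> {0..2*pi} \<longrightarrow> P x)"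
  by (simp add: AE_restrict_space_iff)

lemma measure_M_singleton: "measure M {x} = 0"
proof -
  have "emeasure M {x} = (\<integral>\<^sup>+y. ennreal (g y) * indicator {x} y \<partial>lborel)"
    by (simp add: M_def emeasure_density)
  also have "\<dots> = (\<integral>\<^sup>+y. 0 \<partial>(lborel :: real measure))"
  proof (rule nn_integral_cong_AE)
    show "AE y in lborel. ennreal (g y) * indicator {x} y = 0"
      using AE_lborel_singleton[of x] by eventually_elim simp
  qed
  finally show ?thesis by (simp add: measure_def)
qed

lemma continuous_on_s: "continuous_on A s"
proof -
  have "isCont (cdf M) x" for x using M.isCont_cdf measure_M_singleton by simp
  then have "continuous_on A (cdf M)" by (simp add: continuous_at_imp_continuous_on)
  then show ?thesis unfolding s_def by (intro continuous_intros)
qed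

lemma s_measurable [measurable]: "s \<in> borel_measurable borel"
  by (rule borel_measurable_continuous_onI[OF continuous_on_s])

lemma s_mono: "x \<le> y \<Longrightarrow> s x \<le> s y"
  unfolding s_def by (intro mult_left_mono M.cdf_nondecreasing) auto

lemma s_bounds: "0 \<le> s x" "s x \<le> 2 * pi"
  using M.cdf_bounded_prob[of x] M.cdf_nonneg[of x] by (simp_all add: s_def)

lemma s_0: "s 0 = 0"
proof -
  have "emeasure M {..0} = (\<integral>\<^sup>+y. ennreal (g y) * indicator {..0} y \<partial>lborel)"
    by (simp add: M_def emeasure_density)
  also have "\<dots> = (\<integral>\<^sup>+y. 0 \<partial>(lborel :: real measure))"
  proof (rule nn_integral_cong_AE)
    show "AE y in lborel. ennreal (g y) * indicator {..0} y = 0"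
      using AE_lborel_singleton[of 0] by eventually_elim (use g_outside in \<open>auto simp: indicator_def\<close>)
  qed
  finally show ?thesis by (simp add: s_def cdf_def measure_def)
qed

lemma s_2pi: "s (2*pi) = 2*pi"
proof -
  have "emeasure M {..2*pi} = (\<integral>\<^sup>+y. ennreal (g y) * indicator {..2*pi} y \<partial>lborel)"
    by (simp add: M_def emeasure_density)
  also have "\<dots> = (\<integral>\<^sup>+y. ennreal (g y) \<partial>lborel)"
    using g_outside by (intro nn_integral_cong) (auto simp: indicator_def)
  finally show ?thesis by (simp add: s_def cdf_def measure_def g_total)
qed

text \<open>An interval without mass would be a set of positive length on which the density vanishes.\<close>
lemma s_strict_mono:
  assumes "0 \<le> x" "x < y" "y \<le> 2*pi"
  shows "s x < s y"
proof (rule ccontr)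
  assume "\<not> s x < s y"
  then have "cdf M x = cdf M y" using s_mono[of x y] assms by (simp add: s_def)
  then have "emeasure M {x<..y} = 0" using M.emeasure_Ioc[of x y] assms by simp
  then have "(\<integral>\<^sup>+t. ennreal (g t) * indicator {x<..y} t \<partial>lborel) = 0"
    by (simp add: M_def emeasure_density)
  then have "AE t in lborel. ennreal (g t) * indicator {x<..y} t = 0"
    by (subst (asm) nn_integral_0_iff_AE) auto
  then have "AE t in lborel. t \<notin> {x<..y}"
    using AE_g_pos
  proof eventually_elim
    case (elim t)
    then show ?case using assms by (auto simp: indicator_def split: if_splits)
  qed
  then have "emeasure lborel {x<..y} = 0"
    by (subst (asm) AE_iff_measurable[of "{x<..y}"]) auto
  then show False using assms by simp
qed

lemma s_surj:
  assumes "0 \<le> t" "t \<le> 2*pi"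
  obtains \<theta> where "\<theta> \<in> {0..2*pi}" "s \<theta> = t"
  using IVT'[of s 0 t "2*pi"] assms continuous_on_s s_0 s_2pi by auto

text \<open>The probability integral transform: \<open>s / (2\<pi>)\<close> is the continuous distribution function of the measure,
so its law is uniform.\<close>
lemma distr_s: "distr M borel s = uniform_angle"
proof (rule cdf_unique)
  show "real_distribution (distr M borel s)" by (rule M.real_distribution_distr) measurable
  show "real_distribution uniform_angle"
    using prob_space_uniform_angle by (simp add: real_distribution_def real_distribution_axioms_def)
  show "cdf (distr M borel s) = cdf uniform_angle"
  proof
    fix x
    have left: "cdf (distr M borel s) x = measure M {\<eta>. s \<eta> \<le> x}"
      by (simp add: cdf_def measure_distr vimage_def M_def)
    have right: "cdf uniform_angle x = measure lborel ({0..2*pi} \<inter> {..x}) / (2*pi)"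
      by (simp add: cdf_def)
    consider "x < 0" | "0 \<le> x" "x < 2*pi" | "2*pi \<le> x" by linarith
    then show "cdf (distr M borel s) x = cdf uniform_angle x"
    proof cases
      case 1
      then have "{\<eta>. s \<eta> \<le> x} = {}" using s_bounds(1) by (auto simp: not_le intro: less_le_trans)
      moreover have "{0..2*pi} \<inter> {..x} = {}" using 1 by auto
      ultimately show ?thesis unfolding left right by simp
    next
      case 2
      obtain \<theta> where th: "\<theta> \<in> {0..2*pi}" "s \<theta> = x" using s_surj 2 by (metis less_imp_le)
      have "{\<eta>. s \<eta> \<le> x} = {..\<theta>}"
      proof (intro equalityI subsetI)
        fix \<eta> assume "\<eta> \<in> {\<eta>. s \<eta> \<le> x}"
        then have le: "s \<eta> \<le> s \<theta>" using th by simp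
        show "\<eta> \<in> {..\<theta>}"
        proof (rule ccontr)
          assume "\<eta> \<notin> {..\<theta>}"
          moreover have "\<theta> \<noteq> 2*pi" using th 2 s_2pi by auto
          ultimately have "s \<theta> < s (min \<eta> (2*pi))" using th by (intro s_strict_mono) auto
          also have "\<dots> \<le> s \<eta>" by (intro s_mono) auto
          finally show False using le by simp
        qed
      qed (use th s_mono in auto)
      moreover have "{0..2*pi} \<inter> {..x} = {0..x}" using 2 by auto
      ultimately show ?thesis unfolding left right using 2 th by (simp add: s_def cdf_def field_simps)
    next
      case 3
      then have "{\<eta>. s \<eta> \<le> x} = UNIV" using s_bounds(2) by (auto intro: order_trans)
      moreover have "{0..2*pi} \<inter> {..x} = {0..2*pi}" using 3 by auto
      ultimately show ?thesis unfolding left right using M.prob_space by (simp add: M_def)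
    qed
  qed
qed

section \<open>Continuity of the logarithmic potential on the closed disc\<close>

definition ker :: "complex \<Rightarrow> real \<Rightarrow> complex" where
  "ker z \<theta> = 1 - z * cis (- s \<theta>)"

lemma continuous_on_ker:
  assumes "continuous_on A a" "continuous_on A b"
  shows "continuous_on A (\<lambda>x. ker (a x) (b x))"
  unfolding ker_def by (intro continuous_intros assms continuous_on_compose2[OF continuous_on_s assms(2)]) auto

lemma ker_measurable [measurable]: "ker z \<in> borel_measurable borel"
  by (rule borel_measurable_continuous_onI) (intro continuous_on_ker[of _ "\<lambda>_. z" "\<lambda>x. x", simplified] continuous_intros)

lemma Re_ker_nonneg: "z \<in> cball 0 1 \<Longrightarrow> 0 \<le> Re (ker z \<theta>)"
  using complex_Re_le_cmod[of "z * cis (- s \<theta>)"] by (simp add: ker_def norm_mult)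

lemma Re_ker_pos: "z \<in> ball 0 1 \<Longrightarrow> 0 < Re (ker z \<theta>)"
  using complex_Re_le_cmod[of "z * cis (- s \<theta>)"] by (simp add: ker_def norm_mult)

lemma cis_eq_iff_Icc:
  assumes "a \<in> {0..2*pi}" "b \<in> {0..2*pi}" "cis a = cis b"
  shows "a = b \<or> {a, b} = {0, 2*pi}"
  using polar_form_cong(3)[of "\<lambda>_. 1" a b 1 1] polar_form_cong(3)[of "\<lambda>_. 1" 0 b 1 1]
     polar_form_cong(3)[of "\<lambda>_. 1" a 0 1 1] assms
  by (auto simp: rcis_def order.order_iff_strict)

text \<open>As \<open>s\<close> is injective, the kernel vanishes at no more than three angles in \<open>[0, 2\<pi>]\<close>.\<close>
lemma AE_ker_nonzero: "AE \<theta> in L. ker z \<theta> \<noteq> 0"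
proof -
  define Z where "Z = {\<theta> \<in> {0..2*pi}. ker z \<theta> = 0}"
  have eq: "cis (s \<theta>) = z" if "\<theta> \<in> Z" for \<theta>
  proof -
    have "z * cis (- s \<theta>) = 1" using that by (simp add: Z_def ker_def)
    then have "z * cis (- s \<theta>) * cis (s \<theta>) = cis (s \<theta>)" by simp
    then show ?thesis by (simp add: mult.assoc cis_mult)
  qed
  have "Z \<subseteq> {0, 2*pi} \<union> {\<theta> \<in> {0<..<2*pi}. cis (s \<theta>) = z}"
    using eq by (auto simp: Z_def less_le)
  moreover have "\<theta> = \<eta>" if "\<theta> \<in> {0<..<2*pi}" "\<eta> \<in> {0<..<2*pi}" "cis (s \<theta>) = z" "cis (s \<eta>) = z" for \<theta> \<eta>
  proof (rule ccontr)
    assume ne: "\<theta> \<noteq> \<eta>"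
    have lt: "0 < s x \<and> s x < 2*pi" if "x \<in> {0<..<2*pi}" for x
      using s_strict_mono[of 0 x] s_strict_mono[of x "2*pi"] that s_0 s_2pi by auto
    have "s \<theta> = s \<eta>" using cis_eq_iff_Icc[of "s \<theta>" "s \<eta>"] that lt[OF that(1)] lt[OF that(2)] by (auto simp: doubleton_eq_iff)
    then show False using ne s_strict_mono[of \<theta> \<eta>] s_strict_mono[of \<eta> \<theta>] that by (cases "\<theta> < \<eta>") auto
  qed
  then have "\<exists>a. {\<theta> \<in> {0<..<2*pi}. cis (s \<theta>) = z} \<subseteq> {a}" by blast
  ultimately have "finite Z" by (meson finite.emptyI finite_UnI finite_insert finite_subset)
  then have "AE \<theta> in lborel. \<theta> \<notin> Z" by (intro AE_not_in) (simp add: finite_imp_null_set_lborel)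
  then show ?thesis unfolding AE_L_iff by (auto simp: Z_def elim: eventually_mono)
qed

text \<open>The factor \<open>g\<close> turns the integral into one over the law of \<open>s\<close>, which is uniform by \<open>distr_s\<close>.\<close>
lemma kernel_bound:
  obtains C where "C \<ge> 0"
    "\<And>z. z \<in> cball 0 1 \<Longrightarrow> (\<integral>\<^sup>+\<theta>. ennreal (g \<theta> * cmod (ker z \<theta>) powr (-1/2)) \<partial>L) \<le> ennreal C"
proof -
  obtain C where C: "C \<ge> 0"
    "\<And>z. z \<in> cball 0 1 \<Longrightarrow> (\<integral>\<^sup>+x. ennreal (cmod (1 - z * cis (- x)) powr (-1/2)) \<partial>uniform_angle) \<le> ennreal C"
    using circle_kernel_bound by blast
  show thesis
  proof (rule that[OF C(1)])
    fix z :: complex assume z: "z \<in> cball 0 1"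
    have [measurable]: "(\<lambda>x. cmod (1 - z * cis (- x))) \<in> borel_measurable borel"
      by (intro borel_measurable_continuous_onI continuous_intros)
    have "(\<integral>\<^sup>+\<theta>. ennreal (g \<theta> * cmod (ker z \<theta>) powr (-1/2)) \<partial>L)
        = (\<integral>\<^sup>+\<theta>. ennreal (g \<theta> * cmod (ker z \<theta>) powr (-1/2)) * indicator {0..2*pi} \<theta> \<partial>lborel)"
      by (subst nn_integral_restrict_space) auto
    also have "\<dots> = (\<integral>\<^sup>+\<theta>. ennreal (g \<theta>) * ennreal (cmod (1 - z * cis (- s \<theta>)) powr (-1/2)) \<partial>lborel)"
      using g_outside by (intro nn_integral_cong) (auto simp: indicator_def ker_def ennreal_mult g_nonneg)
    also have "\<dots> = (\<integral>\<^sup>+\<theta>. ennreal (cmod (1 - z * cis (- s \<theta>)) powr (-1/2)) \<partial>M)"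
      unfolding M_def by (subst nn_integral_density) (auto intro: measurable_compose[OF s_measurable])
    also have "\<dots> = (\<integral>\<^sup>+x. ennreal (cmod (1 - z * cis (- x)) powr (-1/2)) \<partial>distr M borel s)"
      by (subst nn_integral_distr) auto
    also have "\<dots> \<le> ennreal C" using C(2)[OF z] by (simp add: distr_s)
    finally show "(\<integral>\<^sup>+\<theta>. ennreal (g \<theta> * cmod (ker z \<theta>) powr (-1/2)) \<partial>L) \<le> ennreal C" .
  qed
qed

text \<open>The part of the bound in \<open>ln_one_plus_le\<close> that depends on the density alone. The default value \<open>ln 0 = 0\<close>
of the logarithm makes it vanish at zeros of \<open>g\<close> when \<open>\<kappa> \<le> 1\<close>; these zeros form a null set.\<close>
definition defect :: "real \<Rightarrow> real \<Rightarrow> real" where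
  "defect \<kappa> \<theta> = max 0 (ln \<kappa> - ln (g \<theta>))"

lemma defect_measurable [measurable]: "defect \<kappa> \<in> borel_measurable borel"
  unfolding defect_def by measurable

lemma integrable_defect:
  assumes "0 < \<kappa>" "\<kappa> \<le> 1" shows "integrable L (defect \<kappa>)"
proof (rule integrableI_nonneg)
  show "defect \<kappa> \<in> borel_measurable L" by (rule measurable_restrict_space1) simp
  show "AE x in L. 0 \<le> defect \<kappa> x" by (simp add: defect_def)
  have "ln \<kappa> \<le> 0" using assms by simp
  have "(\<integral>\<^sup>+x. ennreal (defect \<kappa> x) \<partial>L) = (\<integral>\<^sup>+x. ennreal (defect \<kappa> x) * indicator {0..2*pi} x \<partial>lborel)"
    by (subst nn_integral_restrict_space) auto
  also have "\<dots> \<le> (\<integral>\<^sup>+x\<in>{0..2*pi}. log_minus (g x) \<partial>lborel)"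
    using \<open>ln \<kappa> \<le> 0\<close> by (intro nn_integral_mono) (auto simp: defect_def log_minus_def indicator_def intro!: ennreal_leI)
  finally show "(\<integral>\<^sup>+x. ennreal (defect \<kappa> x) \<partial>L) < \<infinity>" using g_szego by simp
qed

text \<open>Dominated convergence, the dominating function \<open>defect 1 = max 0 (- ln g)\<close> being integrable by the Szego condition.\<close>
lemma integral_defect_tendsto_0: "(\<lambda>n. \<integral>\<theta>. defect (inverse (real (Suc n))) \<theta> \<partial>L) \<longlonglongrightarrow> 0"
proof -
  have "(\<lambda>n. \<integral>\<theta>. defect (inverse (real (Suc n))) \<theta> \<partial>L) \<longlonglongrightarrow> (\<integral>\<theta>. 0 \<partial>L)"
  proof (rule integral_dominated_convergence[where w="defect 1"])
    show "integrable L (defect 1)" by (rule integrable_defect) auto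
    show "AE \<theta> in L. (\<lambda>n. defect (inverse (real (Suc n))) \<theta>) \<longlonglongrightarrow> 0"
    proof (intro AE_I2)
      fix \<theta>
      have neg: "ln (inverse (real (Suc n))) \<le> 0" for n by (simp add: inverse_le_1_iff)
      show "(\<lambda>n. defect (inverse (real (Suc n))) \<theta>) \<longlonglongrightarrow> 0"
      proof (cases "g \<theta> = 0")
        case True
        then show ?thesis using neg by (simp add: defect_def max_absorb1)
      next
        case False
        then have pos: "g \<theta> > 0" using g_nonneg[of \<theta>] by simp
        have "\<forall>\<^sub>F n in sequentially. inverse (real (Suc n)) < g \<theta>"
          using LIMSEQ_inverse_real_of_nat pos by (rule order_tendstoD)
        then have "\<forall>\<^sub>F n in sequentially. defect (inverse (real (Suc n))) \<theta> = 0"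
          by eventually_elim (use pos in \<open>simp add: defect_def max_def\<close>)
        then show ?thesis by (rule tendsto_eventually)
      qed
    qed
    show "AE \<theta> in L. norm (defect (inverse (real (Suc n))) \<theta>) \<le> defect 1 \<theta>" for n
      by (intro AE_I2) (auto simp: defect_def inverse_le_1_iff intro: order_trans[of _ 0] max.coboundedI2)
    show "defect (inverse (real (Suc n))) \<in> borel_measurable L" for n
      by (rule measurable_restrict_space1) simp
  qed simp
  then show ?thesis by simp
qed

definition G :: "complex \<Rightarrow> complex" where
  "G z = (\<integral>\<theta>. Ln (ker z \<theta>) \<partial>L)"

text \<open>Adding \<open>\<epsilon> > 0\<close> moves the argument of the logarithm off the singularity, uniformly on the closed disc.\<close>
definition G_reg :: "real \<Rightarrow> complex \<Rightarrow> complex" where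
  "G_reg \<epsilon> z = (\<integral>\<theta>. Ln (ker z \<theta> + of_real \<epsilon>) \<partial>L)"

lemma
  fixes \<phi> :: "real \<Rightarrow> 'a::euclidean_space"
  assumes "continuous_on {0..2*pi} \<phi>"
  shows integrable_L_continuous: "integrable L \<phi>"
    and integral_L_continuous: "(\<integral>\<theta>. \<phi> \<theta> \<partial>L) = integral {0..2*pi} \<phi>"
proof -
  have "set_integrable lborel {0..2*pi} \<phi>" using assms by (rule borel_integrable_atLeastAtMost')
  then show "integrable L \<phi>" "(\<integral>\<theta>. \<phi> \<theta> \<partial>L) = integral {0..2*pi} \<phi>"
    using set_borel_integral_eq_integral(2)[of "{0..2*pi}" \<phi>]
    by (simp_all add: integrable_restrict_space integral_restrict_space set_integrable_def set_lebesgue_integral_def)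
qed

lemma continuous_on_Ln_ker_reg:
  assumes "\<epsilon> > 0"
  shows "continuous_on (cball 0 1 \<times> X) (\<lambda>(z, t). Ln (ker z t + of_real \<epsilon>))"
  unfolding case_prod_unfold
proof (intro continuous_intros continuous_on_add continuous_on_const continuous_on_ker continuous_on_fst continuous_on_snd continuous_on_id)
  fix p :: "complex \<times> real" assume "p \<in> cball 0 1 \<times> X"
  then have "0 < Re (ker (fst p) (snd p) + of_real \<epsilon>)"
    using Re_ker_nonneg[of "fst p" "snd p"] assms by auto
  then show "ker (fst p) (snd p) + of_real \<epsilon> \<notin> \<real>\<^sub>\<le>\<^sub>0" by (simp add: complex_nonpos_Reals_iff)
qed

lemma integrable_Ln_ker_reg:
  assumes "\<epsilon> > 0" "z \<in> cball 0 1"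
  shows "integrable L (\<lambda>\<theta>. Ln (ker z \<theta> + of_real \<epsilon>))"
  by (intro integrable_L_continuous continuous_on_compose2[OF continuous_on_Ln_ker_reg[OF assms(1), of "{0..2*pi}"], of _ "\<lambda>\<theta>. (z, \<theta>)", simplified] continuous_intros)
     (use assms in auto)

lemma continuous_on_G_reg:
  assumes "\<epsilon> > 0" shows "continuous_on (cball 0 1) (G_reg \<epsilon>)"
proof -
  have "continuous_on (cball 0 1) (\<lambda>z. integral (cbox 0 (2*pi)) (\<lambda>t. Ln (ker z t + of_real \<epsilon>)))"
    by (rule integral_continuous_on_param) (rule continuous_on_Ln_ker_reg[OF assms])
  moreover have "G_reg \<epsilon> z = integral (cbox 0 (2*pi)) (\<lambda>t. Ln (ker z t + of_real \<epsilon>))" if "z \<in> cball 0 1" for z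
    unfolding G_reg_def cbox_interval
    by (intro integral_L_continuous continuous_on_compose2[OF continuous_on_Ln_ker_reg[OF assms(1), of "{0..2*pi}"], of _ "\<lambda>\<theta>. (z, \<theta>)", simplified] continuous_intros)
       (use that in auto)
  ultimately show ?thesis using continuous_on_cong[OF refl, of "cball 0 1" "G_reg \<epsilon>"] by simp
qed

lemma Ln_ker_reg_bound:
  assumes "z \<in> cball 0 1" "0 < \<kappa>" "0 < \<epsilon>"
  shows "AE \<theta> in L. cmod (Ln (ker z \<theta> + of_real \<epsilon>) - Ln (ker z \<theta>)) \<le>
      4 * defect \<kappa> \<theta> + 4 * (sqrt \<epsilon> / \<kappa>) * (g \<theta> * cmod (ker z \<theta>) powr (-1/2))"
proof -
  have "AE \<theta> in L. 0 < g \<theta>" unfolding AE_L_iff by (rule AE_g_pos)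
  then show ?thesis
    using AE_ker_nonzero[of z]
    by eventually_elim (use Ln_add_of_real_bound' Re_ker_nonneg assms in \<open>auto simp: defect_def\<close>)
qed

lemma
  assumes z: "z \<in> cball 0 1"
  shows integrable_kernel: "integrable L (\<lambda>\<theta>. g \<theta> * cmod (ker z \<theta>) powr (-1/2))"
    and integrable_Ln_ker: "integrable L (\<lambda>\<theta>. Ln (ker z \<theta>))"
proof -
  obtain C where C: "(\<integral>\<^sup>+\<theta>. ennreal (g \<theta> * cmod (ker z \<theta>) powr (-1/2)) \<partial>L) \<le> ennreal C"
    using kernel_bound z by metis
  show k: "integrable L (\<lambda>\<theta>. g \<theta> * cmod (ker z \<theta>) powr (-1/2))"
  proof (rule integrableI_nonneg)
    show "(\<lambda>\<theta>. g \<theta> * cmod (ker z \<theta>) powr (-1/2)) \<in> borel_measurable L"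
      by (rule measurable_restrict_space1) measurable
    show "AE \<theta> in L. 0 \<le> g \<theta> * cmod (ker z \<theta>) powr (-1/2)" by (simp add: g_nonneg)
    show "(\<integral>\<^sup>+\<theta>. ennreal (g \<theta> * cmod (ker z \<theta>) powr (-1/2)) \<partial>L) < \<infinity>"
      using C by (simp add: order_le_less_trans)
  qed
  have "integrable L (\<lambda>\<theta>. Ln (ker z \<theta> + of_real 1) - Ln (ker z \<theta>))"
  proof (rule Bochner_Integration.integrable_bound)
    show "integrable L (\<lambda>\<theta>. 4 * defect 1 \<theta> + 4 * (sqrt 1 / 1) * (g \<theta> * cmod (ker z \<theta>) powr (-1/2)))"
      using k integrable_defect[of 1] by (intro Bochner_Integration.integrable_add integrable_mult_right) auto
    show "(\<lambda>\<theta>. Ln (ker z \<theta> + of_real 1) - Ln (ker z \<theta>)) \<in> borel_measurable L"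
      by (rule measurable_restrict_space1) measurable
    show "AE \<theta> in L. norm (Ln (ker z \<theta> + of_real 1) - Ln (ker z \<theta>)) \<le>
        norm (4 * defect 1 \<theta> + 4 * (sqrt 1 / 1) * (g \<theta> * cmod (ker z \<theta>) powr (-1/2)))"
      using Ln_ker_reg_bound[OF z zero_less_one zero_less_one]
      by eventually_elim auto
  qed
  from Bochner_Integration.integrable_diff[OF integrable_Ln_ker_reg[OF zero_less_one z] this]
  show "integrable L (\<lambda>\<theta>. Ln (ker z \<theta>))" by simp
qed

text \<open>By \<open>Ln_ker_reg_bound\<close>, the distance of \<open>G_reg \<epsilon>\<close> from \<open>G\<close> is at most a multiple of the integral of \<open>defect \<kappa>\<close>
plus \<open>C sqrt \<epsilon> / \<kappa>\<close> with \<open>C\<close> from \<open>kernel_bound\<close>; one fixes a small \<open>\<kappa>\<close> before letting \<open>\<epsilon>\<close> tend to \<open>0\<close>.\<close>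
lemma uniform_limit_G_reg: "uniform_limit (cball 0 1) (\<lambda>n. G_reg (inverse (real (Suc n)))) G sequentially"
proof (rule uniform_limitI)
  fix e :: real assume e: "e > 0"
  obtain C where C: "C \<ge> 0"
    "\<And>z. z \<in> cball 0 1 \<Longrightarrow> (\<integral>\<^sup>+\<theta>. ennreal (g \<theta> * cmod (ker z \<theta>) powr (-1/2)) \<partial>L) \<le> ennreal C"
    using kernel_bound by blast
  have est: "dist (G_reg \<epsilon> z) (G z) \<le> 4 * (\<integral>\<theta>. defect \<kappa> \<theta> \<partial>L) + 4 * (sqrt \<epsilon> / \<kappa>) * C"
    if z: "z \<in> cball 0 1" and k: "0 < \<kappa>" "\<kappa> \<le> 1" and ep: "0 < \<epsilon>" for z \<kappa> \<epsilon>
  proof -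
    have i: "integrable L (\<lambda>\<theta>. Ln (ker z \<theta> + of_real \<epsilon>))" "integrable L (\<lambda>\<theta>. Ln (ker z \<theta>))"
      by (rule integrable_Ln_ker_reg[OF ep z], rule integrable_Ln_ker[OF z])
    have ik: "(\<integral>\<theta>. g \<theta> * cmod (ker z \<theta>) powr (-1/2) \<partial>L) \<le> C"
      using C(2)[OF z] nn_integral_eq_integral[OF integrable_kernel[OF z]] C(1) by (simp add: g_nonneg)
    have "dist (G_reg \<epsilon> z) (G z) = cmod (\<integral>\<theta>. Ln (ker z \<theta> + of_real \<epsilon>) - Ln (ker z \<theta>) \<partial>L)"
      using i by (simp add: G_def G_reg_def dist_norm)
    also have "\<dots> \<le> (\<integral>\<theta>. cmod (Ln (ker z \<theta> + of_real \<epsilon>) - Ln (ker z \<theta>)) \<partial>L)"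
      by (rule integral_norm_bound)
    also have "\<dots> \<le> (\<integral>\<theta>. 4 * defect \<kappa> \<theta> + 4 * (sqrt \<epsilon> / \<kappa>) * (g \<theta> * cmod (ker z \<theta>) powr (-1/2)) \<partial>L)"
      using i integrable_defect[OF k] integrable_kernel[OF z] Ln_ker_reg_bound[OF z k(1) ep]
      by (intro integral_mono_AE Bochner_Integration.integrable_add integrable_mult_right integrable_norm Bochner_Integration.integrable_diff)
    also have "\<dots> = 4 * (\<integral>\<theta>. defect \<kappa> \<theta> \<partial>L) + 4 * (sqrt \<epsilon> / \<kappa>) * (\<integral>\<theta>. g \<theta> * cmod (ker z \<theta>) powr (-1/2) \<partial>L)"
      using integrable_defect[OF k] integrable_kernel[OF z] by (subst Bochner_Integration.integral_add) auto
    also have "\<dots> \<le> 4 * (\<integral>\<theta>. defect \<kappa> \<theta> \<partial>L) + 4 * (sqrt \<epsilon> / \<kappa>) * C"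
      using ik k ep by (intro add_left_mono mult_left_mono) auto
    finally show ?thesis .
  qed
  have "\<forall>\<^sub>F n in sequentially. (\<integral>\<theta>. defect (inverse (real (Suc n))) \<theta> \<partial>L) < e / 8"
    using order_tendstoD(2)[OF integral_defect_tendsto_0, of "e / 8"] e by simp
  then obtain m where m: "(\<integral>\<theta>. defect (inverse (real (Suc m))) \<theta> \<partial>L) < e / 8"
    by (auto simp: eventually_sequentially)
  define \<kappa> where "\<kappa> = inverse (real (Suc m))"
  have k: "0 < \<kappa>" "\<kappa> \<le> 1" by (simp_all add: \<kappa>_def inverse_le_1_iff)
  have "(\<lambda>n. 4 * (sqrt (inverse (real (Suc n))) / \<kappa>) * C) \<longlonglongrightarrow> 4 * (sqrt 0 / \<kappa>) * C"
    using k by (intro tendsto_intros LIMSEQ_inverse_real_of_nat) auto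
  then have "\<forall>\<^sub>F n in sequentially. 4 * (sqrt (inverse (real (Suc n))) / \<kappa>) * C < e / 2"
    using e by (intro order_tendstoD(2)) auto
  then show "\<forall>\<^sub>F n in sequentially. \<forall>z\<in>cball 0 1. dist (G_reg (inverse (real (Suc n))) z) (G z) < e"
  proof eventually_elim
    case (elim n)
    show ?case
    proof
      fix z :: complex assume z: "z \<in> cball 0 1"
      show "dist (G_reg (inverse (real (Suc n))) z) (G z) < e"
        using est[OF z k, of "inverse (real (Suc n))"] elim m by (simp add: \<kappa>_def)
    qed
  qed
qed

lemma continuous_on_G: "continuous_on (cball 0 1) G"
  by (rule uniform_limit_theorem[OF _ uniform_limit_G_reg])
     (auto intro!: always_eventually continuous_on_G_reg)

section \<open>The conformal map\<close>

lemma has_field_derivative_G: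
  assumes z: "z \<in> ball 0 1"
  shows "(G has_field_derivative (\<integral>t. - cis (- s t) / ker z t \<partial>L)) (at z)"
proof -
  have nz: "ker z t \<noteq> 0" if "z \<in> ball 0 1" for z t using Re_ker_pos[OF that, of t] by auto
  have cis_s: "continuous_on X (\<lambda>x. cis (- s (a x)))" if "continuous_on X a" for X :: "'a::topological_space set" and a
    by (intro continuous_intros continuous_on_compose2[OF continuous_on_s that]) auto
  have contd: "continuous_on (ball 0 1 \<times> cbox 0 (2*pi)) (\<lambda>(z, t). - cis (- s t) / ker z t)"
    unfolding case_prod_unfold
    by (intro continuous_intros continuous_on_ker cis_s) (use nz in auto)
  have np: "ker z t \<notin> \<real>\<^sub>\<le>\<^sub>0" if "z \<in> ball 0 1" for z t
    using Re_ker_pos[OF that, of t] by (simp add: complex_nonpos_Reals_iff)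
  have contL: "continuous_on X (\<lambda>t. Ln (ker z t))" if "z \<in> ball 0 1" for z X
    by (intro continuous_intros continuous_on_ker) (rule np[OF that])
  have "((\<lambda>z. integral (cbox 0 (2*pi)) (\<lambda>t. Ln (ker z t))) has_field_derivative
      integral (cbox 0 (2*pi)) (\<lambda>t. - cis (- s t) / ker z t)) (at z within ball 0 1)"
  proof (rule leibniz_rule_field_derivative[OF _ _ contd z])
    fix z :: complex and t :: real assume z: "z \<in> ball 0 1" "t \<in> cbox 0 (2*pi)"
    show "((\<lambda>z. Ln (ker z t)) has_field_derivative - cis (- s t) / ker z t) (at z within ball 0 1)"
      using np[OF z(1), of t] unfolding ker_def by (auto intro!: derivative_eq_intros simp: divide_inverse mult.commute)
  next
    fix z :: complex assume "z \<in> ball 0 1"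
    then show "(\<lambda>t. Ln (ker z t)) integrable_on cbox 0 (2*pi)"
      by (intro integrable_continuous contL)
  qed simp
  moreover have "integral (cbox 0 (2*pi)) (\<lambda>t. Ln (ker z t)) = G z" if "z \<in> ball 0 1" for z
    unfolding G_def by (simp add: integral_L_continuous[OF contL[OF that]])
  moreover have "integral (cbox 0 (2*pi)) (\<lambda>t. - cis (- s t) / ker z t) = (\<integral>t. - cis (- s t) / ker z t \<partial>L)"
    unfolding cbox_interval
    by (rule integral_L_continuous[symmetric], intro continuous_intros continuous_on_ker cis_s) (use nz[OF z] in auto)
  ultimately have "(G has_field_derivative (\<integral>t. - cis (- s t) / ker z t \<partial>L)) (at z within ball 0 1)"
    using z by (metis (no_types, lifting) has_field_derivative_transform_within zero_less_one)
  then show ?thesis using z by (simp add: at_within_open[OF z open_ball])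
qed

text \<open>The rotation that normalises the boundary argument of \<open>f\<close> at the angle \<open>s \<theta>\<close> to be exactly \<open>\<theta>\<close>.\<close>
definition c0 :: real where
  "c0 = (\<integral>\<theta>. s \<theta> \<partial>L) / (2 * pi) - pi"

definition f :: "complex \<Rightarrow> complex" where
  "f z = z * exp (- \<i> * of_real c0 - G z / of_real pi)"

lemma continuous_on_f: "continuous_on (cball 0 1) f"
  unfolding f_def by (intro continuous_intros continuous_on_G) auto

lemma holomorphic_on_f: "f holomorphic_on ball 0 1"
proof -
  have "G holomorphic_on ball 0 1"
    using has_field_derivative_G by (metis holomorphic_on_open open_ball)
  then show ?thesis unfolding f_def by (intro holomorphic_intros) auto
qed

lemma f_0: "f 0 = 0" by (simp add: f_def)

lemma measure_L_space: "measure L (space L) = 2 * pi"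
  by (simp add: measure_restrict_space space_restrict_space)

text \<open>A branch of \<open>log f\<close> in the logarithmic coordinate \<open>\<zeta> = log z\<close>, defined on the left half-plane and satisfying
\<open>log_f (\<zeta> + 2\<pi>i) = log_f \<zeta> + 2\<pi>i\<close>.\<close>
definition log_f :: "complex \<Rightarrow> complex" where
  "log_f \<zeta> = \<zeta> - \<i> * of_real c0 - G (exp \<zeta>) / of_real pi"

lemma exp_log_f: "exp (log_f \<zeta>) = f (exp \<zeta>)"
proof -
  have "log_f \<zeta> = \<zeta> + (- \<i> * of_real c0 - G (exp \<zeta>) / of_real pi)" by (simp add: log_f_def)
  then show ?thesis by (simp only: exp_add f_def)
qed

text \<open>The derivative is \<open>z f'(z) / f(z)\<close> at \<open>z = exp \<zeta>\<close>, an average of the functions \<open>(1 + v)/(1 - v) = 2/(1 - v) - 1\<close>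
with \<open>|v| = |z| < 1\<close>, which have positive real part.\<close>
lemma inj_on_log_f: "inj_on log_f {\<zeta>. Re \<zeta> < 0}"
proof (rule inj_on_if_Re_deriv_pos)
  show "convex {\<zeta>. Re \<zeta> < 0}" by (rule convex_halfspace_Re_lt)
  fix \<zeta> :: complex assume "\<zeta> \<in> {\<zeta>. Re \<zeta> < 0}"
  then have e: "exp \<zeta> \<in> ball 0 1" and e1: "cmod (exp \<zeta>) < 1" by (simp_all add: norm_exp_eq_Re)
  let ?D = "\<integral>t. - cis (- s t) / ker (exp \<zeta>) t \<partial>L"
  have "((\<lambda>\<zeta>. G (exp \<zeta>)) has_field_derivative ?D * exp \<zeta>) (at \<zeta>)"
    by (rule DERIV_chain2[OF has_field_derivative_G[OF e] DERIV_exp])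
  then show "(log_f has_field_derivative 1 - ?D * exp \<zeta> / of_real pi) (at \<zeta>)"
    unfolding log_f_def by (auto intro!: derivative_eq_intros)
  define r where "r = cmod (exp \<zeta>)"
  have nz: "ker (exp \<zeta>) t \<noteq> 0" for t using Re_ker_pos[OF e, of t] by auto
  have cont: "continuous_on {0..2*pi} (\<lambda>t. 1 / ker (exp \<zeta>) t)"
    by (intro continuous_intros continuous_on_ker) (use nz in auto)
  note int = integrable_L_continuous[OF cont]
  have "?D * exp \<zeta> = (\<integral>t. - cis (- s t) / ker (exp \<zeta>) t * exp \<zeta> \<partial>L)"
    by (rule integral_mult_left_zero[symmetric])
  also have "\<dots> = (\<integral>t. 1 - 1 / ker (exp \<zeta>) t \<partial>L)"
    by (intro Bochner_Integration.integral_cong refl) (use nz in \<open>simp add: field_simps, simp add: ker_def\<close>)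
  also have "\<dots> = of_real (2 * pi) - (\<integral>t. 1 / ker (exp \<zeta>) t \<partial>L)"
    using int measure_L_space by (subst Bochner_Integration.integral_diff) (auto simp: scaleR_conv_of_real)
  finally have "Re (?D * exp \<zeta>) = 2 * pi - (\<integral>t. Re (1 / ker (exp \<zeta>) t) \<partial>L)"
    using int by simp
  moreover have "2 * pi * (1 / (1 + r)) \<le> (\<integral>t. Re (1 / ker (exp \<zeta>) t) \<partial>L)"
  proof -
    have "2 * pi * (1 / (1 + r)) = (\<integral>t. 1 / (1 + r) \<partial>L)"
      using measure_L_space by simp
    also have "\<dots> \<le> (\<integral>t. Re (1 / ker (exp \<zeta>) t) \<partial>L)"
    proof (rule integral_mono)
      fix t
      have "cmod (exp \<zeta> * cis (- s t)) = r" by (simp add: norm_mult r_def)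
      then show "1 / (1 + r) \<le> Re (1 / ker (exp \<zeta>) t)"
        using Re_inverse_one_minus_ge[of "exp \<zeta> * cis (- s t)"] e1 unfolding ker_def r_def by auto
    qed (use int in auto)
    finally show ?thesis .
  qed
  moreover have "1 / (1 + r) > 1 / 2" using e1 by (simp add: r_def field_simps add_pos_nonneg)
  then have "2 * pi * (1 / (1 + r)) > 2 * pi * (1 / 2)" by (intro mult_strict_left_mono) auto
  ultimately have "Re (?D * exp \<zeta>) < pi" by linarith
  then show "0 < Re (1 - ?D * exp \<zeta> / of_real pi)"
    unfolding minus_complex.sel one_complex.sel Re_divide_of_real by simp
qed

text \<open>Injectivity descends from the half-plane to the disc because \<open>log_f\<close> commutes with the translation by \<open>2\<pi>i\<close>.\<close>
lemma inj_on_f_ball: "inj_on f (ball 0 1)"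
proof (rule inj_onI)
  fix z w assume z: "z \<in> ball 0 1" and w: "w \<in> ball 0 1" and eq: "f z = f w"
  have zero: "f x = 0 \<longleftrightarrow> x = 0" for x by (simp add: f_def)
  show "z = w"
  proof (cases "z = 0")
    case True
    then show ?thesis using eq zero by metis
  next
    case False
    then have w0: "w \<noteq> 0" using eq zero by metis
    have re: "Re (Ln z) < 0" "Re (Ln w) < 0" using z w False w0 by simp_all
    have "exp (log_f (Ln z)) = exp (log_f (Ln w))" using eq False w0 by (simp add: exp_log_f)
    then obtain n :: int where n: "log_f (Ln z) = log_f (Ln w) + of_int (2 * n) * pi * \<i>"
      by (auto simp: exp_eq)
    \<comment> \<open>Equal values of \<open>f\<close> give values of \<open>log_f\<close> that differ by a period; the period is moved into the argument.\<close>
    have per: "exp (Ln w + of_int (2 * n) * pi * \<i>) = exp (Ln w)"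
      unfolding exp_eq by blast
    then have "log_f (Ln w + of_int (2 * n) * pi * \<i>) = log_f (Ln w) + of_int (2 * n) * pi * \<i>"
      unfolding log_f_def per by simp
    then have "log_f (Ln z) = log_f (Ln w + of_int (2 * n) * pi * \<i>)" using n by simp
    then have "Ln z = Ln w + of_int (2 * n) * pi * \<i>"
      by (rule inj_onD[OF inj_on_log_f]) (use re in auto)
    then have "exp (Ln z) = exp (Ln w)" using per by simp
    then show ?thesis using False w0 by simp
  qed
qed

text \<open>Up to the null set \<open>{0, \<theta>, 2\<pi>}\<close> the imaginary part of the integrand at \<open>\<eta>\<close> is
\<open>(s \<theta> - s \<eta> - \<pi>)/2\<close> for \<open>\<eta> < \<theta>\<close> and \<open>(s \<theta> - s \<eta> + \<pi>)/2\<close> for \<open>\<eta> > \<theta>\<close>. The jump by \<open>\<pi>\<close> at \<open>\<eta> = \<theta>\<close> produces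
the term \<open>- \<pi> \<theta>\<close>.\<close>
lemma Im_G_boundary:
  assumes \<theta>: "\<theta> \<in> {0..2*pi}"
  shows "Im (G (cis (s \<theta>))) = pi * (s \<theta> - \<theta> - c0)"
proof -
  have z: "cis (s \<theta>) \<in> cball 0 1" by simp
  have s_int: "integrable L s" by (rule integrable_L_continuous[OF continuous_on_s])
  have ind_int: "integrable L (indicator {..\<theta>} :: real \<Rightarrow> real)"
    by (intro L.integrable_const_bound[of _ 1] AE_I2) (auto simp: indicator_def intro: measurable_restrict_space1)
  have ind_val: "(\<integral>\<eta>. indicat_real {..\<theta>} \<eta> \<partial>L) = \<theta>"
  proof -
    have "(\<integral>\<eta>. indicat_real {..\<theta>} \<eta> \<partial>L) = (\<integral>\<eta>. indicat_real {0..2*pi} \<eta> * indicat_real {..\<theta>} \<eta> \<partial>lborel)"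
      by (subst integral_restrict_space) auto
    also have "\<dots> = (\<integral>\<eta>. indicat_real {0..\<theta>} \<eta> \<partial>lborel)"
      using \<theta> by (intro Bochner_Integration.integral_cong) (auto simp: indicator_def)
    finally show ?thesis using \<theta> by simp
  qed
  have "Im (G (cis (s \<theta>))) = (\<integral>\<eta>. Im (Ln (ker (cis (s \<theta>)) \<eta>)) \<partial>L)"
    unfolding G_def using integrable_Ln_ker[OF z] by simp
  also have "\<dots> = (\<integral>\<eta>. (s \<theta> + pi) / 2 - s \<eta> / 2 - pi * indicator {..\<theta>} \<eta> \<partial>L)"
  proof (rule integral_cong_AE)
    show "(\<lambda>\<eta>. Im (Ln (ker (cis (s \<theta>)) \<eta>))) \<in> borel_measurable L"
      using integrable_Ln_ker[OF z] by auto
    show "(\<lambda>\<eta>. (s \<theta> + pi) / 2 - s \<eta> / 2 - pi * indicator {..\<theta>} \<eta>) \<in> borel_measurable L"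
      using s_int ind_int by auto
    have "AE \<eta> in lborel. \<eta> \<noteq> 0" "AE \<eta> in lborel. \<eta> \<noteq> 2*pi" "AE \<eta> in lborel. \<eta> \<noteq> \<theta>"
      by (rule AE_lborel_singleton)+
    then show "AE \<eta> in L. Im (Ln (ker (cis (s \<theta>)) \<eta>)) = (s \<theta> + pi) / 2 - s \<eta> / 2 - pi * indicator {..\<theta>} \<eta>"
      unfolding AE_L_iff
    proof eventually_elim
      case (elim \<eta>)
      show ?case
      proof
        assume "\<eta> \<in> {0..2*pi}"
        then have eta: "0 < \<eta>" "\<eta> < 2*pi" "\<eta> \<noteq> \<theta>" using elim by auto
        have s_eta: "0 < s \<eta>" "s \<eta> < 2*pi"
          using s_strict_mono[of 0 \<eta>] s_strict_mono[of \<eta> "2*pi"] eta s_0 s_2pi by auto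
        have k: "ker (cis (s \<theta>)) \<eta> = 1 - cis (s \<theta> - s \<eta>)" by (simp add: ker_def cis_mult)
        show "Im (Ln (ker (cis (s \<theta>)) \<eta>)) = (s \<theta> + pi) / 2 - s \<eta> / 2 - pi * indicator {..\<theta>} \<eta>"
        proof (cases "\<eta> < \<theta>")
          case True
          then have "0 < s \<theta> - s \<eta>" "s \<theta> - s \<eta> < 2*pi"
            using s_strict_mono[of \<eta> \<theta>] \<theta> eta s_eta s_bounds[of \<theta>] by auto
          from Im_Ln_one_minus_cis(1)[OF this] show ?thesis using True unfolding k by (simp add: field_simps)
        next
          case False
          then have "0 < s \<eta> - s \<theta>" "s \<eta> - s \<theta> < 2*pi"
            using s_strict_mono[of \<theta> \<eta>] \<theta> eta s_eta s_bounds[of \<theta>] by auto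
          from Im_Ln_one_minus_cis(2)[OF this] show ?thesis using False eta unfolding k by (simp add: field_simps)
        qed
      qed
    qed
  qed
  also have "\<dots> = 2 * pi * ((s \<theta> + pi) / 2) - (\<integral>\<eta>. s \<eta> \<partial>L) / 2 - pi * \<theta>"
  proof -
    have "(\<integral>\<eta>. (s \<theta> + pi) / 2 - s \<eta> / 2 - pi * indicator {..\<theta>} \<eta> \<partial>L) =
        (\<integral>\<eta>. (s \<theta> + pi) / 2 \<partial>L) - (\<integral>\<eta>. s \<eta> / 2 \<partial>L) - (\<integral>\<eta>. pi * indicator {..\<theta>} \<eta> \<partial>L)"
      using s_int ind_int
      by simp
    moreover have "(\<integral>\<eta>. (s \<theta> + pi) / 2 \<partial>L) = 2 * pi * ((s \<theta> + pi) / 2)"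
      using measure_L_space by simp
    moreover have "(\<integral>\<eta>. s \<eta> / 2 \<partial>L) = (\<integral>\<eta>. s \<eta> \<partial>L) / 2"
      by (rule integral_divide_zero)
    moreover have "(\<integral>\<eta>. pi * indicat_real {..\<theta>} \<eta> \<partial>L) = pi * \<theta>"
      by (simp only: integral_mult_right_zero ind_val)
    ultimately show ?thesis by (simp only:)
  qed
  also have "\<dots> = pi * (s \<theta> - \<theta> - c0)"
    by (simp add: c0_def field_simps)
  finally show ?thesis .
qed

definition \<rho> :: "real \<Rightarrow> real" where
  "\<rho> \<theta> = exp (- Re (G (cis (s \<theta>))) / pi)"

lemma f_boundary:
  assumes "\<theta> \<in> {0..2*pi}"
  shows "f (cis (s \<theta>)) = rcis (\<rho> \<theta>) \<theta>"
proof -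
  let ?G = "G (cis (s \<theta>))"
  have e: "\<i> * of_real (s \<theta>) + (- \<i> * of_real c0 - ?G / of_real pi) = of_real (- Re ?G / pi) + \<i> * of_real \<theta>"
    using Im_G_boundary[OF assms] by (simp add: complex_eq_iff Re_divide_of_real Im_divide_of_real field_simps)
  have "f (cis (s \<theta>)) = exp (\<i> * of_real (s \<theta>) + (- \<i> * of_real c0 - ?G / of_real pi))"
    unfolding f_def exp_add by (simp add: cis_conv_exp)
  also have "\<dots> = rcis (\<rho> \<theta>) \<theta>"
    unfolding e exp_add by (simp add: \<rho>_def rcis_def cis_conv_exp exp_of_real del: of_real_divide of_real_minus)
  finally show ?thesis .
qed

lemma \<rho>_pos: "0 < \<rho> \<theta>" by (simp add: \<rho>_def)

lemma continuous_on_\<rho>: "continuous_on X \<rho>"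
  unfolding \<rho>_def
  by (intro continuous_intros continuous_on_compose2[OF continuous_on_G] continuous_on_s) auto

lemma \<rho>_periodic: "\<rho> 0 = \<rho> (2*pi)"
  by (simp add: \<rho>_def s_0 s_2pi)

text \<open>The point \<open>1\<close> of the circle corresponds to both end points of \<open>[0, 2\<pi>]\<close>, so one of them is dropped.\<close>
lemma sphere_param:
  assumes "z \<in> sphere 0 1"
  obtains \<theta> where "\<theta> \<in> {0..<2*pi}" "z = cis (s \<theta>)"
proof -
  have z: "z = cis (Arg2pi z)" "0 \<le> Arg2pi z" "Arg2pi z < 2*pi"
    using Arg2pi[of z] assms by (auto simp: is_Arg_def cis_conv_exp)
  obtain \<theta> where th: "\<theta> \<in> {0..2*pi}" "s \<theta> = Arg2pi z" using s_surj z by (metis less_imp_le)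
  have "\<theta> \<noteq> 2*pi" using th z s_2pi by auto
  then show thesis using that[of \<theta>] th z by auto
qed

lemma f_image_sphere: "f ` sphere 0 1 = (\<lambda>\<theta>. rcis (\<rho> \<theta>) \<theta>) ` {0..2*pi}"
proof (intro equalityI subsetI)
  fix w assume "w \<in> f ` sphere 0 1"
  then obtain z where "z \<in> sphere 0 1" "w = f z" by blast
  then obtain \<theta> where "\<theta> \<in> {0..<2*pi}" "w = f (cis (s \<theta>))" using sphere_param by metis
  then show "w \<in> (\<lambda>\<theta>. rcis (\<rho> \<theta>) \<theta>) ` {0..2*pi}" by (auto simp: f_boundary)
next
  fix w assume "w \<in> (\<lambda>\<theta>. rcis (\<rho> \<theta>) \<theta>) ` {0..2*pi}"
  then obtain \<theta> where "\<theta> \<in> {0..2*pi}" "w = f (cis (s \<theta>))" using f_boundary by auto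
  then show "w \<in> f ` sphere 0 1" by auto
qed

lemma inj_on_f: "inj_on f (cball 0 1)"
proof (rule inj_on_cball_if_inj_on_ball_sphere[OF continuous_on_f holomorphic_on_f inj_on_f_ball])
  show "inj_on f (sphere 0 1)"
  proof (rule inj_onI)
    fix z w assume "z \<in> sphere 0 1" "w \<in> sphere 0 1" and eq: "f z = f w"
    then obtain \<theta> \<eta> where th: "\<theta> \<in> {0..<2*pi}" "z = cis (s \<theta>)" "\<eta> \<in> {0..<2*pi}" "w = cis (s \<eta>)"
      using sphere_param by metis
    then have "rcis (\<rho> \<theta>) \<theta> = rcis (\<rho> \<eta>) \<eta>" using eq by (simp add: f_boundary)
    then have "\<theta> = \<eta>"
      using polar_form_cong(3)[OF \<rho>_periodic, of \<theta> \<eta> "\<rho> \<theta>" "\<rho> \<eta>"] th \<rho>_pos less_imp_le by auto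
    then show "z = w" using th by simp
  qed
qed

lemma f_image_ball: "f ` ball 0 1 = star_domain \<rho>"
  by (rule conformal_image_eq_star_domain)
     (use continuous_on_f holomorphic_on_f inj_on_f f_0 \<rho>_pos \<rho>_periodic f_image_sphere in auto)

section \<open>The radial projection of harmonic measure\<close>

lemma strictly_star_shaped_image: "strictly_star_shaped (star_domain \<rho>)"
  unfolding strictly_star_shaped_def star_domain_def
  using continuous_on_\<rho> \<rho>_pos \<rho>_periodic by blast

text \<open>Harmonic measure at \<open>0\<close> is the law of \<open>f (cis t)\<close> for a uniform angle \<open>t\<close>, and \<open>s\<close> produces a uniform angle from \<open>M\<close>.\<close>
lemma harmonic_measure_star_domain:
  assumes "E \<in> sets borel"
  shows "harmonic_measure 0 E (star_domain \<rho>) = emeasure M {\<theta>. f (cis (s \<theta>)) \<in> E}"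
proof -
  have "is_harmonic_measure 0 (star_domain \<rho>) \<mu> \<longleftrightarrow> \<mu> = distr uniform_angle borel (\<lambda>t. f (cis t))" for \<mu>
    using is_harmonic_measure_conformal_image_iff[OF continuous_on_f inj_on_f holomorphic_on_f]
    by (simp add: f_0 f_image_ball)
  then have "harmonic_measure 0 E (star_domain \<rho>) = emeasure (distr uniform_angle borel (\<lambda>t. f (cis t))) E"
    by (simp add: harmonic_measure_def)
  also have "distr uniform_angle borel (\<lambda>t. f (cis t)) = distr M borel (\<lambda>\<theta>. f (cis (s \<theta>)))"
  proof -
    have "continuous_on UNIV (\<lambda>t. f (cis t))"
      by (rule continuous_on_compose2[OF continuous_on_f]) (auto intro!: continuous_intros)
    then have "(\<lambda>t. f (cis t)) \<in> borel_measurable borel" by (rule borel_measurable_continuous_onI)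
    then show ?thesis by (subst distr_s[symmetric], subst distr_distr) (auto simp: o_def)
  qed
  also have "emeasure (distr M borel (\<lambda>\<theta>. f (cis (s \<theta>)))) E = emeasure M {\<theta>. f (cis (s \<theta>)) \<in> E}"
  proof -
    have "continuous_on UNIV (\<lambda>\<theta>. f (cis (s \<theta>)))"
      by (rule continuous_on_compose2[OF continuous_on_f]) (auto intro!: continuous_intros continuous_on_s)
    then have [measurable]: "(\<lambda>\<theta>. f (cis (s \<theta>))) \<in> borel_measurable borel" by (rule borel_measurable_continuous_onI)
    show ?thesis using assms by (subst emeasure_distr) (auto simp: vimage_def M_def)
  qed
  finally show ?thesis .
qed

lemma Arg2pi_measurable [measurable]: "Arg2pi \<in> borel_measurable borel"
  by (rule borel_measurableI_le) (simp add: closed_Arg2pi2pi_le borel_closed)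

text \<open>The boundary point \<open>f (cis (s \<theta>))\<close> has argument \<open>\<theta>\<close>, except for \<open>\<theta> = 2\<pi>\<close>, where \<open>Arg2pi\<close> is \<open>0\<close>; this is a
null set.\<close>
lemma radial_harmonic_measure_star_domain:
  assumes F: "F \<in> sets borel"
  shows "harmonic_measure 0 {\<zeta> \<in> frontier (star_domain \<rho>). Arg2pi \<zeta> \<in> F} (star_domain \<rho>) = emeasure M F"
proof -
  let ?E = "{\<zeta> \<in> frontier (star_domain \<rho>). Arg2pi \<zeta> \<in> F}"
  have fro: "frontier (star_domain \<rho>) = f ` sphere 0 1"
    using frontier_conformal_image[OF continuous_on_f inj_on_f holomorphic_on_f] by (simp add: f_image_ball)
  have "?E = frontier (star_domain \<rho>) \<inter> Arg2pi -` F \<inter> space borel" by auto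
  also have "\<dots> \<in> sets borel"
    using measurable_sets[OF Arg2pi_measurable F] borel_closed[OF frontier_closed] by (simp add: Int_assoc sets.Int)
  finally have E: "?E \<in> sets borel" .
  have "continuous_on UNIV (\<lambda>\<theta>. f (cis (s \<theta>)))"
    by (rule continuous_on_compose2[OF continuous_on_f]) (auto intro!: continuous_intros continuous_on_s)
  then have "(\<lambda>\<theta>. f (cis (s \<theta>))) \<in> borel_measurable borel" by (rule borel_measurable_continuous_onI)
  from measurable_sets[OF this E] have sets: "{\<theta>. f (cis (s \<theta>)) \<in> ?E} \<in> sets M"
    by (simp add: vimage_def M_def)
  have "AE \<theta> in M. \<theta> \<in> {\<theta>. f (cis (s \<theta>)) \<in> ?E} \<longleftrightarrow> \<theta> \<in> F"
    unfolding M_def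
  proof (subst AE_density)
    show "AE \<theta> in lborel. 0 < ennreal (g \<theta>) \<longrightarrow> (\<theta> \<in> {\<theta>. f (cis (s \<theta>)) \<in> ?E} \<longleftrightarrow> \<theta> \<in> F)"
      using AE_lborel_singleton[of "2*pi"]
    proof eventually_elim
      case (elim \<theta>)
      show ?case
      proof
        assume "0 < ennreal (g \<theta>)"
        then have th: "\<theta> \<in> {0..2*pi}" "\<theta> < 2*pi" using g_outside[of \<theta>] elim by fastforce+
        have "Arg2pi (rcis (\<rho> \<theta>) \<theta>) = \<theta>"
          by (rule Arg2pi_unique[of "\<rho> \<theta>"]) (use th \<rho>_pos in \<open>auto simp: rcis_def cis_conv_exp\<close>)
        moreover have "f (cis (s \<theta>)) \<in> frontier (star_domain \<rho>)" by (simp add: fro)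
        ultimately show "\<theta> \<in> {\<theta>. f (cis (s \<theta>)) \<in> ?E} \<longleftrightarrow> \<theta> \<in> F"
          using f_boundary[OF th(1)] by simp
      qed
    qed
  qed simp
  then have "emeasure M {\<theta>. f (cis (s \<theta>)) \<in> ?E} = emeasure M F"
    by (rule emeasure_eq_AE) (use sets F in \<open>auto simp: M_def\<close>)
  then show ?thesis using harmonic_measure_star_domain[OF E] by simp
qed

end

theorem corollary4:
  fixes \<nu> :: "real measure" and g :: "real \<Rightarrow> real"
  assumes "prob_space \<nu>"
    and "g \<in> L_minus 0 (2*pi)"
    and "\<nu> = density (restrict_space lborel {0..2*pi}) (\<lambda>s. ennreal (g s))"
  shows "\<exists>\<Omega>. strictly_star_shaped \<Omega> \<and> \<nu> = radial_projection \<Omega>"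
proof -
  \<comment> \<open>The hypotheses say nothing about \<open>g\<close> outside \<open>[0, 2\<pi>]\<close>.\<close>
  define h where "h x = indicator {0..2*pi} x * g x" for x
  have g: "\<And>x. x \<in> {0..2*pi} \<Longrightarrow> 0 \<le> g x" "set_integrable lborel {0..2*pi} g"
    "(\<integral>\<^sup>+x\<in>{0..2*pi}. log_minus (g x) \<partial>lborel) < \<infinity>"
    using assms(2) by (auto simp: L_minus_def)
  have h_meas: "h \<in> borel_measurable borel"
    using g(2) unfolding set_integrable_def h_def by (auto dest: borel_measurable_integrable)
  have g_meas: "(\<lambda>x. ennreal (g x)) \<in> borel_measurable (restrict_space lborel {0..2*pi})"
  proof -
    have "(\<lambda>x. ennreal (h x)) \<in> borel_measurable (restrict_space lborel {0..2*pi})"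
      using h_meas by (intro measurable_restrict_space1) simp
    then show ?thesis
      by (rule measurable_cong[THEN iffD1, rotated]) (simp add: h_def space_restrict_space)
  qed
  have nu: "emeasure \<nu> F = (\<integral>\<^sup>+x. ennreal (h x) * indicator F x \<partial>lborel)" if F: "F \<in> sets \<nu>" for F
  proof -
    have F': "F \<in> sets (restrict_space lborel {0..2*pi})" using F by (simp add: assms(3))
    have "emeasure \<nu> F = (\<integral>\<^sup>+x. ennreal (g x) * indicator F x \<partial>restrict_space lborel {0..2*pi})"
      unfolding assms(3) by (rule emeasure_density[OF g_meas F'])
    also have "\<dots> = (\<integral>\<^sup>+x. ennreal (g x) * indicator F x * indicator {0..2*pi} x \<partial>lborel)"
      by (subst nn_integral_restrict_space) auto
    also have "\<dots> = (\<integral>\<^sup>+x. ennreal (h x) * indicator F x \<partial>lborel)"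
      by (intro nn_integral_cong) (auto simp: h_def indicator_def)
    finally show ?thesis .
  qed
  have space_nu: "space \<nu> = {0..2*pi}" and sets_nu: "sets \<nu> = sets (restrict_space borel {0..2*pi})"
    by (simp_all add: assms(3) space_restrict_space sets_restrict_space)
  interpret szego_density h
  proof
    show "h \<in> borel_measurable borel" by (rule h_meas)
    show "0 \<le> h x" for x using g(1) by (auto simp: h_def indicator_def)
    show "h x = 0" if "x \<notin> {0..2*pi}" for x using that by (simp add: h_def)
    have "(\<integral>\<^sup>+x. ennreal (h x) \<partial>lborel) = (\<integral>\<^sup>+x. ennreal (h x) * indicator (space \<nu>) x \<partial>lborel)"
      by (intro nn_integral_cong) (auto simp: space_nu h_def indicator_def)
    also have "\<dots> = emeasure \<nu> (space \<nu>)" by (rule nu[symmetric]) simp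
    also have "\<dots> = 1" using assms(1) by (rule prob_space.emeasure_space_1)
    finally show "(\<integral>\<^sup>+x. ennreal (h x) \<partial>lborel) = 1" .
    have "(\<integral>\<^sup>+x\<in>{0..2*pi}. log_minus (h x) \<partial>lborel) = (\<integral>\<^sup>+x\<in>{0..2*pi}. log_minus (g x) \<partial>lborel)"
      by (intro nn_integral_cong) (auto simp: h_def indicator_def)
    then show "(\<integral>\<^sup>+x\<in>{0..2*pi}. log_minus (h x) \<partial>lborel) < \<infinity>" using g(3) by simp
  qed
  have "radial_projection (star_domain \<rho>) = measure_of (space \<nu>) (sets \<nu>) (emeasure \<nu>)"
    unfolding radial_projection_def space_nu sets_nu
  proof (rule measure_of_eq)
    show "sets (restrict_space borel {0..2*pi}) \<subseteq> Pow {0..2*pi}"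
      using sets.space_closed[of "restrict_space borel {0..2*pi}"] by (simp add: space_restrict_space)
    fix F assume "F \<in> sigma_sets {0..2*pi} (sets (restrict_space borel {0..2*pi}))"
    then have F: "F \<in> sets \<nu>"
      using sets.sigma_sets_eq[of "restrict_space borel {0..2*pi}"] by (simp add: sets_nu space_restrict_space)
    then have "F \<in> sets borel" by (auto simp: sets_nu sets_restrict_space)
    then show "harmonic_measure 0 {\<zeta> \<in> frontier (star_domain \<rho>). Arg2pi \<zeta> \<in> F} (star_domain \<rho>) = emeasure \<nu> F"
      using nu[OF F] by (simp add: radial_harmonic_measure_star_domain M_def emeasure_density)
  qed
  then have "\<nu> = radial_projection (star_domain \<rho>)" by (simp add: measure_of_of_measure)
  then show ?thesis using strictly_star_shaped_image by blast
qed

end
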